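(* For complex $q$ with $|q|<1$ and complex $z$ with $(z,z^{-1};q)_\infty\neq0$ and $z\ne -1$, define \begin{align*} S_{L7}(z;q)&=\frac{(-q;q)_\infty}{(z,z^{-1};q^2)_\infty}\sum_{n=1}^\infty\frac{(z,z^{-1};q^2)_n\,q^{2n}}{(-q;q)_{2n}},\quad S_{L9}(z;q)=\frac{(q;q^2)_\infty}{(z,z^{-1};q)_\infty}\sum_{n=1}^\infty\frac{(z,z^{-1};q)_n\,q^{n}}{(q;q^2)_{n}},\\ S_{L12}(z;q)&=\frac{(-q;q^2)_\infty^2}{(z,z^{-1};q^2)_\infty}\sum_{n=1}^\infty\frac{(z,z^{-1};q^2)_n\,q^{2n}}{(-q;q^2)_{n}(-q;q^2)_{n+1}}. \end{align*} Then \begin{align*} S_{L7}(z;q)&=\frac{1}{(1+z)(q^2,z,z^{-1};q^2)_\infty}\sum_{j=0}^\infty\sum_{n=-j}^{j}(1-z^{j-|n|+1})(1-z^{j-|n|})z^{|n|-j}(-1)^{j+n}q^{j(j+1)-\frac{n(n-1)}{2}},\\ S_{L9}(z;q)&=\frac{1}{(1+z)(q,z,z^{-1};q)_\infty}\sum_{j=0}^\infty\sum_{n=-\lfloor j/2\rfloor}^{\lfloor j/2\rfloor}(1-z^{j-2|n|+1})(1-z^{j-2|n|})z^{2|n|-j}(-1)^{j+n}q^{\frac{j(j+1)}{2}-n(n-1)},\\ S_{L12}(z;q)&=\frac{1}{(1+z)(q^2,z,z^{-1};q^2)_\infty}\sum_{j=0}^\infty\sum_{n=-j}^{j}(1-z^{j-|n|+1})(1-z^{j-|n|})z^{|n|-j}(-1)^{j+n}q^{j(j+1)+n}.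 \end{align*}
   Context: Standard $q$-Pochhammer notation: $(a;q)_n=\prod_{j=0}^{n-1}(1-aq^j)$, $(a;q)_\infty=\prod_{j=0}^{\infty}(1-aq^j)$, and $(a_1,\dots,a_k;q)_n=(a_1;q)_n\cdots(a_k;q)_n$. *)

theory Defs
  imports "HOL-Analysis.Analysis"
begin

definition qpoch :: "complex \<Rightarrow> complex \<Rightarrow> nat \<Rightarrow> complex" where
  "qpoch a q n = (\<Prod>j<n. 1 - a * q ^ j)"

definition qpoch_inf :: "complex \<Rightarrow> complex \<Rightarrow> complex" where
  "qpoch_inf a q = (\<Prod>j. 1 - a * q ^ j)"

text \<open>
  In the three definitions below the summation index of the source runs over \<open>n \<ge> 1\<close>;
  it appears here as \<open>Suc n\<close>. Symbols with several parameters, such as the one for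
  \<open>z\<close> and \<open>1/z\<close>, are written out as products.
\<close>

definition S_L7 :: "complex \<Rightarrow> complex \<Rightarrow> complex" where
  "S_L7 z q =
     qpoch_inf (-q) q / (qpoch_inf z (q^2) * qpoch_inf (inverse z) (q^2)) *
     (\<Sum>n. qpoch z (q^2) (Suc n) * qpoch (inverse z) (q^2) (Suc n) * q ^ (2 * Suc n)
            / qpoch (-q) q (2 * Suc n))"

definition S_L9 :: "complex \<Rightarrow> complex \<Rightarrow> complex" where
  "S_L9 z q =
     qpoch_inf q (q^2) / (qpoch_inf z q * qpoch_inf (inverse z) q) *
     (\<Sum>n. qpoch z q (Suc n) * qpoch (inverse z) q (Suc n) * q ^ Suc n
            / qpoch q (q^2) (Suc n))"

definition S_L12 :: "complex \<Rightarrow> complex \<Rightarrow> complex" where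
  "S_L12 z q =
     (qpoch_inf (-q) (q^2))^2 / (qpoch_inf z (q^2) * qpoch_inf (inverse z) (q^2)) *
     (\<Sum>n. qpoch z (q^2) (Suc n) * qpoch (inverse z) (q^2) (Suc n) * q ^ (2 * Suc n)
            / (qpoch (-q) (q^2) (Suc n) * qpoch (-q) (q^2) (Suc n + 1)))"

end

theory Submission
  imports Defs
begin

text \<open>
  Let \<open>p\<close> be the base (\<open>q\<close> or \<open>q\<^sup>2\<close>). Multiplying by \<open>1 + z\<close> gives the clean expansion
  \<open>(1 + z) (z, 1/z; p)\<^sub>n = \<Sum>\<^sub>k (-1)\<^sup>k p\<^bsup>k(k-1)/2\<^esup> (1 - p\<^bsup>2k+1\<^esup>) (p;p)\<^bsub>2n\<^esub> / ((p;p)\<^bsub>n-k\<^esub> (p;p)\<^bsub>n+k+1\<^esub>) (z\<^bsup>-k\<^esup> + z\<^bsup>k+1\<^esup>)\<close>,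
  and since the left-hand side vanishes at \<open>z = 1\<close> for \<open>n \<ge> 1\<close>, one may replace \<open>z\<^bsup>-k\<^esup> + z\<^bsup>k+1\<^esup>\<close> by
  \<open>z\<^bsup>-k\<^esup> + z\<^bsup>k+1\<^esup> - z - 1 = (1 - z\<^bsup>k+1\<^esup>) (1 - z\<^bsup>k\<^esup>) z\<^bsup>-k\<^esup>\<close>, which is the factor on the right-hand sides of the
  theorem with \<open>k = j - |n|\<close> (or \<open>j - 2|n|\<close>). So it suffices to compare the coefficients of this factor.
  On the right they are partial theta functions of \<open>k\<close>, which satisfy a first-order recurrence in \<open>k\<close>.
  On the left they are sums over \<open>r = n - k\<close> whose summands satisfy the same recurrence up to a difference
  \<open>U(r+1) - U(r)\<close> with an explicit \<open>U\<close>. A bounded solution of the recurrence is unique.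
\<close>

subsection \<open>q-Pochhammer symbols\<close>

lemma qpoch_0 [simp]: "qpoch a q 0 = 1"
  by (simp add: qpoch_def)

lemma qpoch_Suc: "qpoch a q (Suc n) = qpoch a q n * (1 - a * q ^ n)"
  by (simp add: qpoch_def)

lemma one_minus_mult_power_nonzero:
  fixes a q :: complex
  assumes "norm a < 1" "norm q < 1"
  shows "1 - a * q ^ n \<noteq> 0"
proof -
  have "norm (a * q ^ n) = norm a * norm q ^ n"
    by (simp add: norm_mult norm_power)
  also have "\<dots> \<le> norm a * 1"
    using assms by (intro mult_left_mono power_le_one) auto
  also have "\<dots> < 1"
    using assms by simp
  finally show ?thesis
    by auto
qed

lemma one_minus_power_Suc_nonzero:
  fixes q :: complex
  assumes "norm q < 1"
  shows "1 - q ^ Suc n \<noteq> 0"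
  using one_minus_mult_power_nonzero[OF assms assms, of n] by simp

lemma qpoch_nonzero:
  assumes "norm a < 1" "norm q < 1"
  shows "qpoch a q n \<noteq> 0"
  using one_minus_mult_power_nonzero[OF assms] by (simp add: qpoch_def)

section \<open>Convergence of the infinite products and uniform bounds on the finite ones\<close>

lemma convergent_prod_qpoch:
  fixes a q :: complex
  assumes "norm q < 1"
  shows "convergent_prod (\<lambda>j. 1 - a * q ^ j)"
proof -
  have "summable (\<lambda>j. norm a * norm q ^ j)"
    using assms by (intro summable_mult summable_geometric) auto
  then have "summable (\<lambda>j. norm ((1 - a * q ^ j) - 1))"
    by (simp add: norm_mult norm_power)
  then show ?thesis
    using abs_convergent_prod_conv_summable abs_convergent_prod_imp_convergent_prod by blast
qed

lemma qpoch_LIMSEQ: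
  assumes "norm q < 1"
  shows "(\<lambda>n. qpoch a q n) \<longlonglongrightarrow> qpoch_inf a q"
proof -
  have "(\<lambda>n. qpoch a q (Suc n)) \<longlonglongrightarrow> qpoch_inf a q"
    using convergent_prod_LIMSEQ[OF convergent_prod_qpoch[OF assms, of a]]
    unfolding qpoch_def qpoch_inf_def lessThan_Suc_atMost .
  then show ?thesis
    by (rule LIMSEQ_imp_Suc)
qed

lemma qpoch_LIMSEQ_compose:
  assumes "norm q < 1" "strict_mono f"
  shows "(\<lambda>n. qpoch a q (f n)) \<longlonglongrightarrow> qpoch_inf a q"
  using LIMSEQ_subseq_LIMSEQ[OF qpoch_LIMSEQ[OF assms(1)] assms(2)] by (simp add: o_def)

lemma qpoch_inf_nonzero:
  assumes "norm a < 1" "norm q < 1"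
  shows "qpoch_inf a q \<noteq> 0"
  unfolding qpoch_inf_def
  using convergent_prod_qpoch[OF assms(2)] one_minus_mult_power_nonzero[OF assms]
  by (intro prodinf_nonzero) auto

lemma qpoch_bounded:
  assumes "norm q < 1"
  obtains M where "M > 0" "\<And>n. norm (qpoch a q n) \<le> M"
  using convergent_imp_Bseq[OF convergentI[OF qpoch_LIMSEQ[OF assms, of a]]]
  unfolding Bseq_def by blast

text \<open>The limit is nonzero, so the reciprocals converge and are therefore bounded. Together
  with \<open>qpoch_bounded\<close> this supplies the constants in the geometric majorants of the
  coefficient sums.\<close>

lemma inverse_qpoch_bounded:
  assumes "norm a < 1" "norm q < 1"
  obtains M where "M > 0" "\<And>n. norm (inverse (qpoch a q n)) \<le> M"
proof -
  have "(\<lambda>n. inverse (qpoch a q n)) \<longlonglongrightarrow> inverse (qpoch_inf a q)"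
    by (intro tendsto_inverse qpoch_LIMSEQ qpoch_inf_nonzero assms)
  from convergent_imp_Bseq[OF convergentI[OF this]] that show ?thesis
    unfolding Bseq_def by blast
qed

text \<open>Even and odd exponents are separated. For \<open>a = q\<close> this cancels the
  denominator \<open>qpoch q (q\<^sup>2) n\<close> of the L9 series.\<close>

lemma qpoch_double: "qpoch a q (2 * n) = qpoch a (q\<^sup>2) n * qpoch (a * q) (q\<^sup>2) n"
  by (induction n) (simp_all add: qpoch_Suc power_mult[symmetric] algebra_simps)

text \<open>A difference of squares in each factor. For \<open>a = q\<close> this cancels the
  denominator \<open>qpoch (-q) q (2 * n)\<close> of the L7 series.\<close>

lemma qpoch_mult_minus: "qpoch a q n * qpoch (- a) q n = qpoch (a\<^sup>2) (q\<^sup>2) n"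
  by (induction n)
    (simp_all add: qpoch_Suc power2_eq_square power_mult_distrib algebra_simps)

lemma qpoch_inf_double:
  assumes "norm q < 1"
  shows "qpoch_inf a q = qpoch_inf a (q\<^sup>2) * qpoch_inf (a * q) (q\<^sup>2)"
proof (rule LIMSEQ_unique)
  have "norm (q\<^sup>2) < 1"
    using assms by (simp add: norm_power power_less_one_iff)
  then show "(\<lambda>n. qpoch a q (2 * n)) \<longlonglongrightarrow> qpoch_inf a (q\<^sup>2) * qpoch_inf (a * q) (q\<^sup>2)"
    unfolding qpoch_double by (intro tendsto_mult qpoch_LIMSEQ)
  show "(\<lambda>n. qpoch a q (2 * n)) \<longlonglongrightarrow> qpoch_inf a q"
    using assms by (intro qpoch_LIMSEQ_compose) (auto simp: strict_mono_def)
qed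

lemma qpoch_inf_mult_minus:
  assumes "norm q < 1"
  shows "qpoch_inf a q * qpoch_inf (- a) q = qpoch_inf (a\<^sup>2) (q\<^sup>2)"
proof (rule LIMSEQ_unique)
  have "norm (q\<^sup>2) < 1"
    using assms by (simp add: norm_power power_less_one_iff)
  then show "(\<lambda>n. qpoch a q n * qpoch (- a) q n) \<longlonglongrightarrow> qpoch_inf (a\<^sup>2) (q\<^sup>2)"
    unfolding qpoch_mult_minus by (intro qpoch_LIMSEQ)
  show "(\<lambda>n. qpoch a q n * qpoch (- a) q n) \<longlonglongrightarrow> qpoch_inf a q * qpoch_inf (- a) q"
    by (intro tendsto_mult qpoch_LIMSEQ assms)
qed

subsection \<open>Expansion of the product in powers of z\<close>

text \<open>
  The coefficients \<open>c\<^sub>k\<close> are understood to be extended by \<open>c\<^sub>-\<^sub>1\<^sub>-\<^sub>k = c\<^sub>k\<close>, matching the symmetry of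
  \<open>z\<^sup>-\<^sup>k + z\<^sup>k\<^sup>+\<^sup>1\<close>; this is why the recurrence at \<open>k = 0\<close> has a shape of its own.
\<close>

definition laurent_coeff :: "complex \<Rightarrow> nat \<Rightarrow> nat \<Rightarrow> complex" where
  "laurent_coeff q n k =
     (if k \<le> n
      then (-1) ^ k * q ^ (k choose 2) * (1 - q ^ (2 * k + 1)) * qpoch q q (2 * n)
             / (qpoch q q (n - k) * qpoch q q (n + k + 1))
      else 0)"

text \<open>Writing \<open>n = k + r\<close> removes the truncated subtraction and the case
  distinction; \<open>r\<close> becomes the summation index of the coefficient sums.\<close>

lemma laurent_coeff_add:
  "laurent_coeff q (k + r) k =
     (-1) ^ k * q ^ (k choose 2) * (1 - q ^ (2 * k + 1)) * qpoch q q (2 * (k + r))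
       / (qpoch q q r * qpoch q q (2 * k + r + 1))"
proof -
  have "k + r + k + 1 = 2 * k + r + 1"
    by simp
  show ?thesis
    unfolding laurent_coeff_def \<open>k + r + k + 1 = 2 * k + r + 1\<close> by simp
qed

lemma qpoch_self_Suc: "qpoch q q (Suc n) = qpoch q q n * (1 - q ^ Suc n)"
  by (simp add: qpoch_Suc)

lemma choose_two_Suc: "Suc k choose 2 = (k choose 2) + k"
  by (simp add: numeral_2_eq_2)

text \<open>Passing from \<open>n\<close> to \<open>Suc n\<close> multiplies the product by
  \<open>1 + q ^ (2 * n) - q ^ n * (z + 1 / z)\<close>. The lower neighbour of index 0 is index -1,
  whose coefficient is again that of index 0.\<close>

lemma laurent_coeff_rec_0:
  assumes q: "norm q < 1"
  shows "laurent_coeff q (Suc n) 0 =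
     (1 + q ^ (2 * n)) * laurent_coeff q n 0 - q ^ n * (laurent_coeff q n 0 + laurent_coeff q n 1)"
\<comment> \<open>For \<open>n = 0\<close> the coefficient of index 1 is out of range and hence 0.
  For \<open>n = Suc r\<close> the closed form applies to all coefficients, and its smallest symbol
  is \<open>qpoch q q r\<close>.\<close>
proof (cases n)
  case 0
  have "1 - q \<noteq> 0" "1 - q * q \<noteq> 0"
    using one_minus_power_Suc_nonzero[OF q, of 0] one_minus_power_Suc_nonzero[OF q, of 1] by auto
  with 0 show ?thesis
    by (simp add: laurent_coeff_def qpoch_Suc numeral_2_eq_2)
next
  case (Suc r)
  note nz = one_minus_power_Suc_nonzero[OF q]
  define x a Q where "x = q ^ r" and "a = qpoch q q r" and "Q = qpoch q q (2 * Suc r)"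
  have a: "a \<noteq> 0"
    unfolding a_def by (intro qpoch_nonzero q)
  have x: "1 - q * x \<noteq> 0" "1 - q ^ 2 * x \<noteq> 0" "1 - q ^ 3 * x \<noteq> 0"
    using nz[of r] nz[of "Suc r"] nz[of "Suc (Suc r)"] by (auto simp: x_def eval_nat_numeral mult_ac)
  have p1: "qpoch q q (Suc r) = a * (1 - q * x)"
    by (simp add: qpoch_self_Suc a_def x_def)
  have p2: "qpoch q q (Suc (Suc r)) = a * (1 - q * x) * (1 - q ^ 2 * x)"
    by (simp add: qpoch_self_Suc a_def x_def eval_nat_numeral mult_ac)
  have p3: "qpoch q q (Suc (Suc (Suc r))) = a * (1 - q * x) * (1 - q ^ 2 * x) * (1 - q ^ 3 * x)"
    by (simp add: qpoch_self_Suc a_def x_def eval_nat_numeral mult_ac)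
  have e: "q ^ Suc r = q * x" "q ^ (2 * Suc r) = q ^ 2 * x ^ 2"
    by (simp_all add: x_def power2_eq_square mult_2 power_add)
  have "qpoch q q (Suc (Suc (2 * Suc r))) = Q * (1 - q * q ^ (2 * Suc r)) * (1 - q * (q * q ^ (2 * Suc r)))"
    by (simp only: qpoch_self_Suc Q_def power_Suc)
  then have Q2: "qpoch q q (2 * Suc (Suc r)) = Q * (1 - q ^ 3 * x ^ 2) * (1 - q ^ 4 * x ^ 2)"
    unfolding e by (simp add: eval_nat_numeral mult_ac)
  have ch: "(0 :: nat) choose 2 = 0" "Suc 0 choose 2 = 0"
    by (simp_all add: numeral_2_eq_2)
  have c1: "laurent_coeff q (Suc (Suc r)) 0 =
     (1 - q) * (Q * (1 - q ^ 3 * x ^ 2) * (1 - q ^ 4 * x ^ 2)) /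
       (a * (1 - q * x) * (1 - q ^ 2 * x) * (a * (1 - q * x) * (1 - q ^ 2 * x) * (1 - q ^ 3 * x)))"
    unfolding laurent_coeff_def Q2 by (simp add: p2 p3 ch)
  have c2: "laurent_coeff q (Suc r) 0 =
     (1 - q) * Q / (a * (1 - q * x) * (a * (1 - q * x) * (1 - q ^ 2 * x)))"
    unfolding laurent_coeff_def Q_def[symmetric] by (simp add: p1 p2 ch)
  have c3: "laurent_coeff q (Suc r) 1 =
     (q ^ 3 - 1) * Q / (a * (a * (1 - q * x) * (1 - q ^ 2 * x) * (1 - q ^ 3 * x)))"
    unfolding laurent_coeff_def Q_def[symmetric]
    by (simp add: p3 ch a_def[symmetric] power3_eq_cube)
  \<comment> \<open>Once the nonzero denominators are cleared, what remains is a polynomial identity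
    in \<open>q\<close>, \<open>x\<close>, \<open>a\<close> and \<open>Q\<close>.\<close>
  show ?thesis
    unfolding Suc c1 c2 c3 e using a x by (simp add: divide_simps) algebra
qed

text \<open>The same multiplication, read off at an index with two genuine neighbours.\<close>

lemma laurent_coeff_rec_Suc:
  assumes q: "norm q < 1"
  shows "laurent_coeff q (Suc n) (Suc i) =
     (1 + q ^ (2 * n)) * laurent_coeff q n (Suc i)
       - q ^ n * (laurent_coeff q n i + laurent_coeff q n (Suc (Suc i)))"
proof -
  note nz = one_minus_power_Suc_nonzero[OF q]
  define s t y where "s = (-1 :: complex) ^ i" and "t = q ^ (i choose 2)" and "y = q ^ i"
  have t: "q ^ (i choose 2) = t" "q ^ (Suc i choose 2) = t * y" "q ^ (Suc (Suc i) choose 2) = t * y * (q * y)"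
    by (simp_all add: t_def y_def choose_two_Suc power_add mult_ac)
  have s: "(-1 :: complex) ^ i = s" "(-1 :: complex) ^ Suc i = - s" "(-1 :: complex) ^ Suc (Suc i) = s"
    by (simp_all add: s_def)
  have m: "q ^ (2 * i + 1) = q * y ^ 2" "q ^ (2 * Suc i + 1) = q ^ 3 * y ^ 2"
    "q ^ (2 * Suc (Suc i) + 1) = q ^ 5 * y ^ 2"
    by (simp_all add: y_def power2_eq_square mult_2 power_add eval_nat_numeral mult_ac)
  \<comment> \<open>For \<open>n < i\<close> all four coefficients vanish. For \<open>n = i\<close>
    and \<open>n = Suc i\<close> some are cut off at the upper end. From \<open>Suc (Suc i)\<close>
    on, the closed form holds for all of them.\<close>
  consider (lt) "n < i" | (eq) "n = i" | (Suc) "n = Suc i" | (gt) r where "n = Suc (Suc i) + r"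
    by (metis Suc_leI le_Suc_ex less_linear less_or_eq_imp_le nat_less_le)
  then show ?thesis
  proof cases
    case lt
    then show ?thesis
      by (simp add: laurent_coeff_def)
  next
    case eq
    define A where "A = qpoch q q (2 * i)"
    have A: "A \<noteq> 0"
      unfolding A_def by (intro qpoch_nonzero q)
    have ny: "1 - q * y ^ 2 \<noteq> 0" "1 - q ^ 2 * y ^ 2 \<noteq> 0" "1 - q ^ 3 * y ^ 2 \<noteq> 0"
      using nz[of "2 * i"] nz[of "2 * i + 1"] nz[of "2 * i + 2"]
      by (auto simp: y_def power2_eq_square mult_2 power_add eval_nat_numeral mult_ac)
    have p: "qpoch q q (2 * i + 1) = A * (1 - q * y ^ 2)"
      "qpoch q q (2 * Suc i) = A * (1 - q * y ^ 2) * (1 - q ^ 2 * y ^ 2)"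
      "qpoch q q (2 * Suc i + 1) = A * (1 - q * y ^ 2) * (1 - q ^ 2 * y ^ 2) * (1 - q ^ 3 * y ^ 2)"
      by (simp_all add: qpoch_self_Suc A_def y_def power2_eq_square mult_2 power_add eval_nat_numeral mult_ac)
    have c: "laurent_coeff q (Suc i) (Suc i) = - (s * (t * y))"
      using laurent_coeff_add[of q "Suc i" 0] A ny unfolding add_0_right s t m p by simp
    have c': "laurent_coeff q i i = s * t"
      using laurent_coeff_add[of q i 0] A ny unfolding add_0_right s t m p A_def[symmetric] by simp
    show ?thesis
      unfolding eq c c' by (simp add: laurent_coeff_def y_def)
  next
    case Suc
    define A where "A = qpoch q q (2 * Suc i)"
    have A: "A \<noteq> 0"
      unfolding A_def by (intro qpoch_nonzero q)
    have nq: "1 - q \<noteq> 0"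
      using nz[of 0] by simp
    have ny: "1 - q ^ 3 * y ^ 2 \<noteq> 0" "1 - q ^ 4 * y ^ 2 \<noteq> 0"
      using nz[of "2 * i + 2"] nz[of "2 * i + 3"]
      by (auto simp: y_def power2_eq_square mult_2 power_add eval_nat_numeral mult_ac)
    have p: "qpoch q q (2 * i + 1 + 1) = A"
      "qpoch q q (2 * Suc i + 1) = A * (1 - q ^ 3 * y ^ 2)"
      "qpoch q q (2 * (Suc i + 1)) = A * (1 - q ^ 3 * y ^ 2) * (1 - q ^ 4 * y ^ 2)"
      "qpoch q q (2 * Suc i + 1 + 1) = A * (1 - q ^ 3 * y ^ 2) * (1 - q ^ 4 * y ^ 2)"
      by (simp_all add: qpoch_self_Suc A_def y_def power2_eq_square mult_2 power_add eval_nat_numeral mult_ac)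
    have p1: "qpoch q q 1 = 1 - q"
      by (simp add: qpoch_def)
    have c: "laurent_coeff q (Suc (Suc i)) (Suc i) = - (s * (t * y) * (1 - q ^ 3 * y ^ 2) / (1 - q))"
      using laurent_coeff_add[of q "Suc i" 1] A ny nq unfolding s t m p p1 by simp
    have c': "laurent_coeff q (Suc i) (Suc i) = - (s * (t * y))"
      using laurent_coeff_add[of q "Suc i" 0] A ny unfolding add_0_right s t m p A_def[symmetric] by simp
    have c'': "laurent_coeff q (Suc i) i = s * t * (1 - q * y ^ 2) / (1 - q)"
      using laurent_coeff_add[of q i 1] A ny nq unfolding s t m p p1 by (simp add: A_def)
    have c0: "laurent_coeff q (Suc i) (Suc (Suc i)) = 0"
      by (simp add: laurent_coeff_def)
    have e: "q ^ Suc i = q * y" "q ^ (2 * Suc i) = q ^ 2 * y ^ 2"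
      by (simp_all add: y_def power2_eq_square mult_2 power_add)
    show ?thesis
      unfolding Suc c c' c'' c0 e using nq by (simp add: divide_simps) algebra
  next
    case (gt r)
    \<comment> \<open>\<open>A\<close> is \<open>qpoch q q (n - i - 2)\<close> and \<open>B\<close>
      is \<open>qpoch q q (n + i + 1)\<close>. With \<open>Q\<close> they are the shortest symbols
      of their kind among the four coefficients, so all others are polynomial multiples of
      them.\<close>
    define x A B Q where "x = q ^ r" and "A = qpoch q q r" and "B = qpoch q q (2 * i + r + 3)"
      and "Q = qpoch q q (2 * n)"
    have AB: "A \<noteq> 0" "B \<noteq> 0"
      unfolding A_def B_def by (intro qpoch_nonzero q)+
    have nx: "1 - q * x \<noteq> 0" "1 - q ^ 2 * x \<noteq> 0"
      "1 - q ^ 4 * x * y ^ 2 \<noteq> 0" "1 - q ^ 5 * x * y ^ 2 \<noteq> 0"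
      using nz[of r] nz[of "Suc r"] nz[of "2 * i + r + 3"] nz[of "2 * i + r + 4"]
      by (auto simp: x_def y_def power2_eq_square mult_2 power_add eval_nat_numeral mult_ac)
    have e: "q ^ n = q ^ 2 * x * y" "q ^ (2 * n) = q ^ 4 * x ^ 2 * y ^ 2"
      by (simp_all add: gt x_def y_def power2_eq_square mult_2 power_add eval_nat_numeral mult_ac)
    have p: "qpoch q q (r + 1) = A * (1 - q * x)"
      "qpoch q q (r + 2) = A * (1 - q * x) * (1 - q ^ 2 * x)"
      by (simp_all add: qpoch_self_Suc A_def x_def eval_nat_numeral mult_ac)
    have p': "qpoch q q (2 * Suc i + (r + 1) + 1) = B * (1 - q ^ 4 * x * y ^ 2)"
      "qpoch q q (2 * Suc i + (r + 2) + 1) = B * (1 - q ^ 4 * x * y ^ 2) * (1 - q ^ 5 * x * y ^ 2)"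
      "qpoch q q (2 * Suc (Suc i) + r + 1) = B * (1 - q ^ 4 * x * y ^ 2) * (1 - q ^ 5 * x * y ^ 2)"
      "qpoch q q (2 * i + (r + 2) + 1) = B"
      by (simp_all add: qpoch_self_Suc B_def x_def y_def power2_eq_square mult_2 power_add
          eval_nat_numeral mult_ac)
    have "qpoch q q (Suc (Suc (2 * n))) = Q * (1 - q * q ^ (2 * n)) * (1 - q * (q * q ^ (2 * n)))"
      by (simp only: qpoch_self_Suc Q_def power_Suc)
    then have Q2: "qpoch q q (2 * (Suc n)) = Q * (1 - q ^ 5 * x ^ 2 * y ^ 2) * (1 - q ^ 6 * x ^ 2 * y ^ 2)"
      unfolding e by (simp add: eval_nat_numeral mult_ac)
    have n: "i + (r + 2) = n" "Suc i + (r + 1) = n" "Suc (Suc i) + r = n" "Suc i + (r + 2) = Suc n"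
      by (simp_all add: gt)
    have c: "laurent_coeff q (Suc n) (Suc i) = - (s * (t * y) * (1 - q ^ 3 * y ^ 2) *
       (Q * (1 - q ^ 5 * x ^ 2 * y ^ 2) * (1 - q ^ 6 * x ^ 2 * y ^ 2)) /
       (A * (1 - q * x) * (1 - q ^ 2 * x) * (B * (1 - q ^ 4 * x * y ^ 2) * (1 - q ^ 5 * x * y ^ 2))))"
      using laurent_coeff_add[of q "Suc i" "r + 2"] unfolding n s t m p p' Q2 by simp
    have c0: "laurent_coeff q n i = s * t * (1 - q * y ^ 2) * Q / (A * (1 - q * x) * (1 - q ^ 2 * x) * B)"
      using laurent_coeff_add[of q "i" "r + 2"] unfolding n s t m p p' Q_def[symmetric] .
    have c1: "laurent_coeff q n (Suc i) = - (s * (t * y) * (1 - q ^ 3 * y ^ 2) * Q /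
        (A * (1 - q * x) * (B * (1 - q ^ 4 * x * y ^ 2))))"
      using laurent_coeff_add[of q "Suc i" "r + 1"] unfolding n s t m p p' Q_def[symmetric] by simp
    have c2: "laurent_coeff q n (Suc (Suc i)) = s * (t * y * (q * y)) * (1 - q ^ 5 * y ^ 2) * Q /
        (A * (B * (1 - q ^ 4 * x * y ^ 2) * (1 - q ^ 5 * x * y ^ 2)))"
      using laurent_coeff_add[of q "Suc (Suc i)" r] unfolding n s t m p p' Q_def[symmetric] A_def[symmetric] .
    show ?thesis
      unfolding c c0 c1 c2 e using AB nx by (simp add: divide_simps) algebra
  qed
qed

text \<open>Induction on \<open>n\<close>: the new pair of factors acts on the basis elements
  through multiplication by \<open>z + 1 / z\<close>, and the coefficient recurrences describe this
  action.\<close>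

lemma qpoch_product_expansion:
  fixes z q :: complex
  assumes q: "norm q < 1" and z: "z \<noteq> 0"
  shows "(1 + z) * (qpoch z q n * qpoch (inverse z) q n) =
     (\<Sum>k\<le>n. laurent_coeff q n k * (inverse z ^ k + z ^ Suc k))"
proof (induction n)
  case 0
  have "1 - q \<noteq> 0"
    using one_minus_power_Suc_nonzero[OF q, of 0] by simp
  then show ?case
    by (simp add: laurent_coeff_def qpoch_def numeral_2_eq_2)
next
  case (Suc n)
  define b where "b k = inverse z ^ k + z ^ Suc k" for k
  define c where "c = laurent_coeff q n"
  \<comment> \<open>\<open>c'\<close> is the sequence \<open>c\<close> moved up by one place, with
    \<open>c 0\<close> in the place of the coefficient of index -1.\<close>
  define c' where "c' k = (case k of 0 \<Rightarrow> c 0 | Suc k \<Rightarrow> c k)" for k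
  have b0: "(z + inverse z) * b 0 = b 0 + b 1"
    using z by (simp add: b_def field_simps power2_eq_square)
  have bS: "(z + inverse z) * b (Suc k) = b k + b (Suc (Suc k))" for k
    using z by (simp add: b_def field_simps)
  \<comment> \<open>Multiplication by \<open>z + 1 / z\<close> is transferred from the basis to the
    coefficients. The two boundary terms vanish at \<open>N = n\<close>, because \<open>c\<close> is
    0 beyond \<open>n\<close>.\<close>
  have shift: "(\<Sum>k\<le>Suc N. (c' k + c (Suc k)) * b k) =
      (z + inverse z) * (\<Sum>k\<le>N. c k * b k) + c (Suc N) * b N + c (Suc (Suc N)) * b (Suc N)" for N
  proof (induction N)
    case 0
    have "(z + inverse z) * (c 0 * b 0) = c 0 * (b 0 + b 1)"
      using b0 by (metis mult.left_commute)
    then show ?case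
      by (simp add: c'_def algebra_simps)
  next
    case (Suc N)
    have "(z + inverse z) * (c (Suc N) * b (Suc N)) = c (Suc N) * (b N + b (Suc (Suc N)))"
      using bS by (metis mult.left_commute)
    moreover have "c' (Suc (Suc N)) = c (Suc N)"
      by (simp add: c'_def)
    ultimately show ?case
      unfolding sum.atMost_Suc[of _ "Suc N"] Suc.IH sum.atMost_Suc[of _ N] distrib_left
      by (simp add: algebra_simps)
  qed
  have c0: "c (Suc n) = 0" "c (Suc (Suc n)) = 0"
    by (simp_all add: c_def laurent_coeff_def)
  have rec: "laurent_coeff q (Suc n) k = (1 + q ^ (2 * n)) * c k - q ^ n * (c' k + c (Suc k))" for k
    using laurent_coeff_rec_0[OF q, of n] laurent_coeff_rec_Suc[OF q, of n]
    by (cases k) (simp_all add: c_def c'_def)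
  have "(\<Sum>k\<le>Suc n. laurent_coeff q (Suc n) k * b k) =
      (1 + q ^ (2 * n)) * (\<Sum>k\<le>Suc n. c k * b k) - q ^ n * (\<Sum>k\<le>Suc n. (c' k + c (Suc k)) * b k)"
    unfolding rec by (simp only: left_diff_distrib sum_subtractf sum_distrib_left mult.assoc)
  also have "\<dots> = (1 + q ^ (2 * n) - q ^ n * (z + inverse z)) * (\<Sum>k\<le>n. c k * b k)"
    unfolding shift by (simp add: c0 algebra_simps)
  also have "1 + q ^ (2 * n) - q ^ n * (z + inverse z) = (1 - z * q ^ n) * (1 - inverse z * q ^ n)"
    using z by (simp add: mult_2 power_add) (simp add: field_simps)
  also have "(\<Sum>k\<le>n. c k * b k) = (1 + z) * (qpoch z q n * qpoch (inverse z) q n)"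
    unfolding Suc.IH b_def c_def ..
  finally show ?case
    unfolding b_def by (simp add: qpoch_Suc mult_ac)
qed

lemma qpoch_product_expansion_centred:
  fixes z q :: complex
  assumes q: "norm q < 1" and z: "z \<noteq> 0" and n: "n > 0"
  shows "(1 + z) * (qpoch z q n * qpoch (inverse z) q n) =
     (\<Sum>k\<le>n. laurent_coeff q n k * (inverse z ^ k + z ^ Suc k - z - 1))"
proof -
  have "qpoch 1 q n = 0"
    using n unfolding qpoch_def by (auto intro!: bexI[of _ 0])
  \<comment> \<open>At \<open>z = 1\<close> every basis element equals 2, and the product contains
    the factor \<open>1 - 1\<close>.\<close>
  then have "(\<Sum>k\<le>n. laurent_coeff q n k) * 2 = 0"
    using qpoch_product_expansion[OF q, of 1 n] by (simp add: sum_distrib_right)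
  then have "(\<Sum>k\<le>n. laurent_coeff q n k) = 0"
    by simp
  moreover have "(\<Sum>k\<le>n. laurent_coeff q n k * (inverse z ^ k + z ^ Suc k - z - 1)) =
      (\<Sum>k\<le>n. laurent_coeff q n k * (inverse z ^ k + z ^ Suc k)) - (z + 1) * (\<Sum>k\<le>n. laurent_coeff q n k)"
    by (simp add: sum_distrib_left sum_subtractf[symmetric] algebra_simps)
  ultimately show ?thesis
    using qpoch_product_expansion[OF q z, of n] by simp
qed

subsection \<open>Telescoping recurrences and partial theta functions\<close>

text \<open>Iterating \<open>n\<close> times expresses \<open>d k\<close> as a product of
  \<open>n\<close> values of \<open>b\<close> times \<open>d (k + n)\<close>, which is at most
  \<open>c ^ n * K\<close> in norm.\<close>

lemma bounded_recurrence_zero: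
  fixes d b :: "nat \<Rightarrow> complex"
  assumes rec: "\<And>k. d k = b k * d (Suc k)"
    and b: "\<And>k. norm (b k) \<le> c" and c: "c < 1"
    and d: "\<And>k. norm (d k) \<le> K"
  shows "d k = 0"
proof -
  have c0: "0 \<le> c"
    using b[of 0] norm_ge_zero order_trans by blast
  have "norm (d k) \<le> c ^ n * K" for n k
  proof (induction n arbitrary: k)
    case (Suc n)
    have "norm (d k) = norm (b k) * norm (d (Suc k))"
      by (metis rec norm_mult)
    also have "\<dots> \<le> c * (c ^ n * K)"
      using Suc b c0 by (intro mult_mono) auto
    finally show ?case
      by (simp add: mult_ac)
  qed (simp add: d)
  moreover have "(\<lambda>n. c ^ n * K) \<longlonglongrightarrow> 0 * K"
    using c c0 by (intro tendsto_intros LIMSEQ_realpow_zero)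
  ultimately have "norm (d k) \<le> 0 * K"
    by (intro LIMSEQ_le_const[where a = "norm (d k)"]) auto
  then show ?thesis
    by simp
qed

text \<open>Creative telescoping with certificate \<open>U\<close>. In \<open>TS\<close> both terms
  on the left belong to the same value \<open>k + r + 1\<close> of the original index
  \<open>n\<close>. Summation over \<open>r\<close> shows that the sums of \<open>T k\<close> obey
  the recurrence of \<open>\<theta>\<close>; the difference of the two is bounded and solves the
  homogeneous recurrence, so it is zero.\<close>

lemma sums_of_telescoping_recurrence:
  fixes T U :: "nat \<Rightarrow> nat \<Rightarrow> complex" and \<theta> L b :: "nat \<Rightarrow> complex"
  assumes T: "\<And>k r. norm (T k r) \<le> M * c ^ r" and c: "0 \<le> c" "c < 1"
    and lim: "\<And>k. U k \<longlonglongrightarrow> L k"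
    and T0: "\<And>k. T k 0 = U k 1"
    and TS: "\<And>k r. T k (Suc r) - b k * T (Suc k) r = U k (Suc (Suc r)) - U k (Suc r)"
    and \<theta>: "\<And>k. \<theta> k = L k + b k * \<theta> (Suc k)" "\<And>k. norm (\<theta> k) \<le> N"
    and b: "\<And>k. norm (b k) \<le> c"
  shows "T k sums \<theta> k"
proof -
  have geo: "summable (\<lambda>r. M * c ^ r)"
    using c by (intro summable_mult summable_geometric) auto
  have nsum: "summable (\<lambda>r. norm (T k r))" for k
    using T by (intro summable_comparison_test'[OF geo]) auto
  then have sum: "summable (T k)" for k
    by (rule summable_norm_cancel)
  have rec: "(\<Sum>r. T k r) = L k + b k * (\<Sum>r. T (Suc k) r)" for k
  proof -
    have "(\<lambda>r. U k (Suc (Suc r)) - U k (Suc r)) sums (L k - U k (Suc 0))"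
      using telescope_sums[OF LIMSEQ_Suc[OF lim[of k]]] by simp
    then have "(\<Sum>r. T k (Suc r) - b k * T (Suc k) r) = L k - U k 1"
      by (simp add: TS sums_iff)
    moreover have "(\<Sum>r. T k (Suc r) - b k * T (Suc k) r) = (\<Sum>r. T k (Suc r)) - b k * (\<Sum>r. T (Suc k) r)"
      using sum[of k] sum[of "Suc k"]
      by (simp add: suminf_diff[symmetric] summable_mult suminf_mult summable_Suc_iff)
    moreover have "(\<Sum>r. T k (Suc r)) = (\<Sum>r. T k r) - T k 0"
      using suminf_split_head[OF sum[of k]] .
    \<comment> \<open>The boundary value \<open>U k 1\<close> of the telescoping sum is exactly the
      split-off term \<open>T k 0\<close>, so only the limit \<open>L k\<close> survives.\<close>
    ultimately show ?thesis
      by (simp add: T0 algebra_simps)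
  qed
  have bound: "norm (\<Sum>r. T k r) \<le> (\<Sum>r. M * c ^ r)" for k
  proof -
    have "norm (\<Sum>r. T k r) \<le> (\<Sum>r. norm (T k r))"
      by (rule summable_norm[OF nsum])
    also have "\<dots> \<le> (\<Sum>r. M * c ^ r)"
      using T by (intro suminf_le nsum geo)
    finally show ?thesis .
  qed
  define d where "d k = (\<Sum>r. T k r) - \<theta> k" for k
  have "d k = 0" for k
  proof (rule bounded_recurrence_zero[where b = b])
    show "d k = b k * d (Suc k)" for k
      unfolding d_def rec[of k] \<theta>(1)[of k] by (simp add: algebra_simps)
    show "norm (d k) \<le> (\<Sum>r. M * c ^ r) + N" for k
      unfolding d_def by (intro order_trans[OF norm_triangle_ineq4] add_mono bound \<theta>(2))
  qed (use b c in auto)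
  then show ?thesis
    using summable_sums[OF sum[of k]] by (simp add: d_def)
qed

section \<open>Geometric bounds and partial theta functions\<close>

lemma norm_suminf_le_geometric:
  fixes f :: "nat \<Rightarrow> complex"
  assumes "\<And>r. norm (f r) \<le> c ^ r" "0 \<le> c" "c < 1"
  shows "summable f" "norm (suminf f) \<le> 1 / (1 - c)"
proof -
  have geo: "summable (\<lambda>r. c ^ r)"
    using assms by (intro summable_geometric) auto
  have n: "summable (\<lambda>r. norm (f r))"
    using assms by (intro summable_comparison_test'[OF geo]) auto
  then show "summable f"
    by (rule summable_norm_cancel)
  have "norm (suminf f) \<le> (\<Sum>r. c ^ r)"
    using assms by (intro order_trans[OF summable_norm[OF n]] suminf_le n geo)
  also have "\<dots> = 1 / (1 - c)"
    using assms by (intro suminf_geometric) auto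
  finally show "norm (suminf f) \<le> 1 / (1 - c)" .
qed

lemma norm_power_le_power:
  fixes q :: complex
  assumes "norm q < 1" "r \<le> e"
  shows "norm (q ^ e) \<le> norm q ^ r"
  using assms by (simp add: norm_power power_decreasing)

text \<open>The exponent is \<open>(r + k + 1)\<^sup>2 - (k + 1)\<^sup>2\<close>. For nonzero
  \<open>q\<close> and \<open>\<epsilon>\<close> this is the tail from \<open>n = k + 1\<close> of
  the theta series with terms \<open>\<epsilon> ^ n * q ^ (n\<^sup>2)\<close>, divided by its first
  term. The sign is -1 for L9 and 1 for L12.\<close>

definition partial_theta :: "complex \<Rightarrow> complex \<Rightarrow> nat \<Rightarrow> complex" where
  "partial_theta \<epsilon> q k = (\<Sum>r. \<epsilon> ^ r * q ^ (r\<^sup>2 + 2 * (k + 1) * r))"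

lemma partial_theta_term_bound:
  fixes \<epsilon> q :: complex
  assumes "norm q < 1" "norm \<epsilon> = 1"
  shows "norm (\<epsilon> ^ r * q ^ (r\<^sup>2 + 2 * (k + 1) * r)) \<le> norm q ^ r"
proof -
  have "r \<le> r\<^sup>2 + 2 * (k + 1) * r"
    by (simp add: trans_le_add2)
  then show ?thesis
    using norm_power_le_power[OF assms(1)] assms(2) by (simp add: norm_mult norm_power)
qed

lemma partial_theta_bounded:
  assumes "norm q < 1" "norm \<epsilon> = 1"
  shows "norm (partial_theta \<epsilon> q k) \<le> 1 / (1 - norm q)"
  unfolding partial_theta_def
  using partial_theta_term_bound[OF assms] assms(1) by (intro norm_suminf_le_geometric) auto

text \<open>Removing the first term of the tail starts it one place later, which is the function at
  \<open>Suc k\<close> up to normalisation.\<close>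

lemma partial_theta_rec:
  assumes "norm q < 1" "norm \<epsilon> = 1"
  shows "partial_theta \<epsilon> q k = 1 + \<epsilon> * q ^ (2 * k + 3) * partial_theta \<epsilon> q (Suc k)"
proof -
  define f where "f k r = \<epsilon> ^ r * q ^ (r\<^sup>2 + 2 * (k + 1) * r)" for k r
  have sum: "summable (f k)" for k
    unfolding f_def using partial_theta_term_bound[OF assms] assms(1)
    by (intro norm_suminf_le_geometric(1)) auto
  have "f k (Suc r) = \<epsilon> * q ^ (2 * k + 3) * f (Suc k) r" for r
  proof -
    have "(Suc r)\<^sup>2 + 2 * (k + 1) * Suc r = (2 * k + 3) + (r\<^sup>2 + 2 * (Suc k + 1) * r)"
      by (simp add: power2_eq_square algebra_simps)
    then show ?thesis
      unfolding f_def by (simp only: power_add power_Suc mult_ac)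
  qed
  then have "(\<Sum>r. f k (Suc r)) = \<epsilon> * q ^ (2 * k + 3) * (\<Sum>r. f (Suc k) r)"
    using sum by (simp add: suminf_mult)
  moreover have "partial_theta \<epsilon> q k = suminf (f k)" for k
    unfolding partial_theta_def f_def ..
  moreover have "f k 0 = 1"
    by (simp add: f_def)
  ultimately show ?thesis
    using suminf_split_head[OF sum, of k] by (simp add: algebra_simps)
qed

subsection \<open>Evaluation of the coefficient sums\<close>

text \<open>Creative telescoping with limit 1 and multiplier \<open>- (q ^ (2 * k + 3))\<close>, the
  data of the recurrence of \<open>partial_theta (-1)\<close>.\<close>

lemma theta_sum_L9:
  fixes q :: complex
  assumes q: "norm q < 1"
  shows "(\<lambda>r. qpoch_inf q q * qpoch_inf q (q\<^sup>2) *
           (q ^ r * qpoch (q\<^sup>2) (q\<^sup>2) (k + r) / (qpoch q q r * qpoch q q (2 * k + r + 1))))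
         sums partial_theta (-1) q k"
proof -
  define p C where "p = q\<^sup>2" and "C = qpoch_inf q q * qpoch_inf q p"
  have p: "norm p < 1"
    using q by (simp add: p_def norm_power power_less_one_iff)
  note nz = one_minus_power_Suc_nonzero[OF q]
  define T where "T k r = C * (q ^ r * qpoch p p (k + r) / (qpoch q q r * qpoch q q (2 * k + r + 1)))"
    for k r
  \<comment> \<open>The certificate is \<open>T\<close> with \<open>q ^ r\<close> replaced by
    \<open>1 - q ^ r\<close>, a factor that is 0 at \<open>r = 0\<close> and tends to 1.\<close>
  define U where "U k r = C * ((1 - q ^ r) * qpoch p p (k + r) / (qpoch q q r * qpoch q q (2 * k + r + 1)))"
    for k r
  obtain M1 where M1: "M1 > 0" "\<And>n. norm (qpoch p p n) \<le> M1"
    using qpoch_bounded[OF p] by blast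
  obtain M2 where M2: "M2 > 0" "\<And>n. norm (inverse (qpoch q q n)) \<le> M2"
    using inverse_qpoch_bounded[OF q q] by blast
  have "T k sums partial_theta (-1) q k" for k
  proof (rule sums_of_telescoping_recurrence[where U = U and L = "\<lambda>_. 1"
        and b = "\<lambda>k. - (q ^ (2 * k + 3))" and c = "norm q"])
    show "norm (T k r) \<le> norm C * M1 * M2 * M2 * norm q ^ r" for k r
    proof -
      have "norm (T k r) = norm C * norm (qpoch p p (k + r)) * norm (inverse (qpoch q q r))
          * norm (inverse (qpoch q q (2 * k + r + 1))) * norm q ^ r"
        by (simp add: T_def divide_inverse norm_mult norm_power)
      also have "\<dots> \<le> norm C * M1 * M2 * M2 * norm q ^ r"
        using M1 M2 by (intro mult_mono order_refl) auto
      finally show ?thesis .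
    qed
    have nzi: "qpoch_inf q q \<noteq> 0"
      by (intro qpoch_inf_nonzero q)
    have "(\<lambda>r. U k r) \<longlonglongrightarrow> C * ((1 - 0) * qpoch_inf p p / (qpoch_inf q q * qpoch_inf q q))" for k
      unfolding U_def
      by (intro tendsto_intros qpoch_LIMSEQ_compose LIMSEQ_power_zero p q qpoch_LIMSEQ)
         (use nzi in \<open>auto simp: strict_mono_def\<close>)
    \<comment> \<open>Splitting \<open>qpoch_inf q q\<close> into its two parts of base
      \<open>q\<^sup>2\<close> shows that \<open>C\<close> normalises the limit to 1.\<close>
    moreover have "C * ((1 - 0) * qpoch_inf p p / (qpoch_inf q q * qpoch_inf q q)) = 1"
      using qpoch_inf_double[OF q, of q] nzi by (simp add: C_def p_def power2_eq_square)
    ultimately show "U k \<longlonglongrightarrow> 1" for k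
      by simp
    show "T k 0 = U k 1" for k
    proof -
      have e: "qpoch p p (k + 1) = qpoch p p k * (1 - q ^ Suc (2 * k + 1))"
        by (simp add: qpoch_Suc p_def power2_eq_square mult_2 mult_2_right power_add power_mult_distrib)
      have e': "qpoch q q (2 * k + 1 + 1) = qpoch q q (2 * k + 1) * (1 - q ^ Suc (2 * k + 1))"
        by (simp add: qpoch_self_Suc)
      have e1: "qpoch q q 1 = 1 - q"
        by (simp add: qpoch_def)
      show ?thesis
        using nz[of "2 * k + 1"] nz[of 0]
        unfolding T_def U_def e e' e1 by simp
    qed
    show "T k (Suc r) - - (q ^ (2 * k + 3)) * T (Suc k) r = U k (Suc (Suc r)) - U k (Suc r)" for k r
    proof -
      define x v P A B where "x = q ^ r" and "v = q ^ k" and "P = qpoch p p (k + Suc r)"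
        and "A = qpoch q q r" and "B = qpoch q q (2 * k + Suc r + 1)"
      have AB: "A \<noteq> 0" "B \<noteq> 0"
        unfolding A_def B_def by (intro qpoch_nonzero q)+
      have nx: "1 - q * x \<noteq> 0" "1 - q ^ 2 * x \<noteq> 0" "1 - q ^ 3 * x * v ^ 2 \<noteq> 0"
        using nz[of r] nz[of "Suc r"] nz[of "2 * k + r + 2"]
        by (auto simp: x_def v_def power2_eq_square mult_2 mult_2_right power_add eval_nat_numeral mult_ac)
      have e: "q ^ Suc r = q * x" "q ^ Suc (Suc r) = q ^ 2 * x" "q ^ (2 * k + 3) = q ^ 3 * v ^ 2"
        by (simp_all add: x_def v_def power2_eq_square mult_2 mult_2_right power_add eval_nat_numeral mult_ac)
      have pA: "qpoch q q (Suc r) = A * (1 - q * x)"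
        "qpoch q q (Suc (Suc r)) = A * (1 - q * x) * (1 - q ^ 2 * x)"
        by (simp_all add: qpoch_self_Suc A_def x_def eval_nat_numeral mult_ac)
      have pB: "qpoch q q (2 * Suc k + r + 1) = B * (1 - q ^ 3 * x * v ^ 2)"
        "qpoch q q (2 * k + Suc (Suc r) + 1) = B * (1 - q ^ 3 * x * v ^ 2)"
        by (simp_all add: qpoch_self_Suc B_def x_def v_def power2_eq_square mult_2 mult_2_right power_add
            eval_nat_numeral mult_ac)
      have pP: "qpoch p p (Suc k + r) = P" "qpoch p p (k + Suc (Suc r)) = P * (1 - q ^ 4 * x ^ 2 * v ^ 2)"
        by (simp_all add: qpoch_self_Suc P_def p_def x_def v_def power2_eq_square power_add
            power_mult_distrib eval_nat_numeral mult_ac)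
      show ?thesis
        unfolding T_def U_def e pA pB pP P_def[symmetric] A_def[symmetric] B_def[symmetric] x_def[symmetric]
        using AB nx by (simp add: divide_simps) algebra
    qed
    show "partial_theta (-1) q k = 1 + - (q ^ (2 * k + 3)) * partial_theta (-1) q (Suc k)" for k
      using partial_theta_rec[OF q, of "-1" k] by simp
    show "norm (partial_theta (-1) q k) \<le> 1 / (1 - norm q)" for k
      using q by (intro partial_theta_bounded) auto
    show "norm (- (q ^ (2 * k + 3))) \<le> norm q" for k
      using norm_power_le_power[OF q, of 1 "2 * k + 3"] by simp
  qed (use q in auto)
  then show ?thesis
    unfolding T_def C_def p_def .
qed

lemma power_square_double: "(q\<^sup>2) ^ k = (q :: complex) ^ (2 * k)"
  by (simp add: power_mult)

text \<open>The same scheme in base \<open>p\<close>, with multiplier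
  \<open>q ^ (2 * k + 3)\<close>. The factor \<open>1 - q ^ (2 * k + 1)\<close> is one half of
  \<open>1 - p ^ (2 * k + 1)\<close>; the other half arises later from pairing positive and negative
  \<open>n\<close>.\<close>

lemma theta_sum_L12:
  fixes q :: complex
  assumes q: "norm q < 1"
  defines "p \<equiv> q\<^sup>2"
  shows "(\<lambda>r. qpoch_inf p p * (qpoch_inf (-q) p)\<^sup>2 * (1 - q ^ (2 * k + 1)) *
           (p ^ r * qpoch p p (2 * (k + r)) / (qpoch (-q) p (k + r) * qpoch (-q) p (k + r + 1)
             * qpoch p p r * qpoch p p (2 * k + r + 1))))
         sums partial_theta 1 q k"
proof -
  define C where "C = qpoch_inf p p * (qpoch_inf (-q) p)\<^sup>2"
  have p: "norm p < 1" and q': "norm (- q) < 1"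
    using q by (simp_all add: p_def norm_power power_less_one_iff)
  note nz = one_minus_power_Suc_nonzero[OF p]
  note nq = one_minus_mult_power_nonzero[OF q' p]
  define T where "T k r = C * (1 - q ^ (2 * k + 1)) *
      (p ^ r * qpoch p p (2 * (k + r)) / (qpoch (-q) p (k + r) * qpoch (-q) p (k + r + 1)
             * qpoch p p r * qpoch p p (2 * k + r + 1)))" for k r
  \<comment> \<open>Relative to \<open>T\<close>, the factor \<open>1 - q ^ (2 * k + 1)\<close> is
    dropped, \<open>p ^ r\<close> becomes \<open>1 - p ^ r\<close>, and both symbols of
    \<open>-q\<close> have length \<open>k + r\<close>.\<close>
  define U where "U k r = C * ((1 - p ^ r) * qpoch p p (2 * (k + r)) /
      ((qpoch (-q) p (k + r))\<^sup>2 * qpoch p p r * qpoch p p (2 * k + r + 1)))" for k r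
  obtain M1 where M1: "M1 > 0" "\<And>n. norm (qpoch p p n) \<le> M1"
    using qpoch_bounded[OF p] by blast
  obtain M2 where M2: "M2 > 0" "\<And>n. norm (inverse (qpoch p p n)) \<le> M2"
    using inverse_qpoch_bounded[OF p p] by blast
  obtain M3 where M3: "M3 > 0" "\<And>n. norm (inverse (qpoch (-q) p n)) \<le> M3"
    using inverse_qpoch_bounded[OF q' p] by blast
  have qw: "q ^ (2 * k + 1) = q * p ^ k" "q ^ (2 * k + 3) = q * p * p ^ k" for k
    by (simp_all add: p_def power_mult_distrib mult_2 power_add power2_eq_square eval_nat_numeral mult_ac)
  have "T k sums partial_theta 1 q k" for k
  proof (rule sums_of_telescoping_recurrence[where U = U and L = "\<lambda>_. 1"
        and b = "\<lambda>k. q ^ (2 * k + 3)" and c = "norm q"])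
    show "norm (T k r) \<le> norm C * 2 * M1 * M3 * M3 * M2 * M2 * norm q ^ r" for k r
    proof -
      have "norm (1 - q ^ (2 * k + 1)) \<le> 1 + norm (q ^ (2 * k + 1))"
        using norm_triangle_ineq4[of 1 "q ^ (2 * k + 1)"] by simp
      also have "\<dots> \<le> 2"
        using norm_power_le_power[OF q, of 0 "2 * k + 1"] by simp
      finally have two: "norm (1 - q ^ (2 * k + 1)) \<le> 2" .
      have pr: "norm (p ^ r) \<le> norm q ^ r"
        unfolding p_def power_square_double by (intro norm_power_le_power q) simp
      have "norm (T k r) = norm C * norm (1 - q ^ (2 * k + 1)) * norm (qpoch p p (2 * (k + r)))
          * norm (inverse (qpoch (-q) p (k + r))) * norm (inverse (qpoch (-q) p (k + r + 1)))
          * norm (inverse (qpoch p p r))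
          * norm (inverse (qpoch p p (2 * k + r + 1))) * norm (p ^ r)"
        unfolding T_def divide_inverse norm_mult inverse_mult_distrib by (simp only: mult_ac)
      also have "\<dots> \<le> norm C * 2 * M1 * M3 * M3 * M2 * M2 * norm q ^ r"
        using M1 M2 M3 by (intro mult_mono order_refl two pr) auto
      finally show ?thesis .
    qed
    have nzi: "qpoch_inf p p \<noteq> 0" "qpoch_inf (-q) p \<noteq> 0"
      by (intro qpoch_inf_nonzero p q')+
    have "(\<lambda>r. U k r) \<longlonglongrightarrow> C * ((1 - 0) * qpoch_inf p p /
        ((qpoch_inf (-q) p)\<^sup>2 * qpoch_inf p p * qpoch_inf p p))" for k
      unfolding U_def
      by (intro tendsto_intros qpoch_LIMSEQ_compose LIMSEQ_power_zero p q qpoch_LIMSEQ)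
         (use nzi in \<open>auto simp: strict_mono_def\<close>)
    moreover have "C * ((1 - 0) * qpoch_inf p p /
        ((qpoch_inf (-q) p)\<^sup>2 * qpoch_inf p p * qpoch_inf p p)) = 1"
      using nzi by (simp add: C_def)
    ultimately show "U k \<longlonglongrightarrow> 1" for k
      by simp
    show "T k 0 = U k 1" for k
    proof -
      define w N Q where "w = p ^ k" and "N = qpoch (-q) p k" and "Q = qpoch p p (2 * k)"
      have nw: "1 - p * w ^ 2 \<noteq> 0" "1 - p ^ 2 * w ^ 2 \<noteq> 0" "1 + q * w \<noteq> 0" "1 - p \<noteq> 0"
        using nz[of "2 * k"] nz[of "2 * k + 1"] nq[of k] nz[of 0]
        by (auto simp: w_def power2_eq_square mult_2 mult_2_right power_add mult_ac)
      have NQ: "N \<noteq> 0" "Q \<noteq> 0"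
        unfolding N_def Q_def by (intro qpoch_nonzero p q')+
      have e: "qpoch (-q) p (k + 1) = N * (1 + q * w)"
        by (simp add: qpoch_Suc N_def w_def)
      have e': "qpoch p p (2 * k + 1) = Q * (1 - p * w ^ 2)"
        "qpoch p p (2 * k + 1 + 1) = Q * (1 - p * w ^ 2) * (1 - p ^ 2 * w ^ 2)"
        "qpoch p p (2 * (k + 1)) = Q * (1 - p * w ^ 2) * (1 - p ^ 2 * w ^ 2)"
        by (simp_all add: qpoch_self_Suc Q_def w_def power2_eq_square mult_2 mult_2_right power_add mult_ac)
      have e1: "qpoch p p 1 = 1 - p"
        by (simp add: qpoch_def)
      \<comment> \<open>Since \<open>p\<close> is the square of \<open>q\<close>, this factor of the
        denominator cancels the extra \<open>1 - q * w\<close> in \<open>T\<close>.\<close>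
      have "1 - p * w ^ 2 = (1 - q * w) * (1 + q * w)"
        unfolding p_def by algebra
      then show ?thesis
        using nw NQ
        unfolding T_def U_def qw add_0_right e e' e1 N_def[symmetric] Q_def[symmetric] w_def[symmetric]
        by (simp add: divide_simps power2_eq_square)
    qed
    show "T k (Suc r) - q ^ (2 * k + 3) * T (Suc k) r = U k (Suc (Suc r)) - U k (Suc r)" for k r
    proof -
      define x w N Q A B where "x = p ^ r" and "w = p ^ k" and "N = qpoch (-q) p (k + Suc r)"
        and "Q = qpoch p p (2 * (k + Suc r))"
        and "A = qpoch p p r" and "B = qpoch p p (2 * k + Suc r + 1)"
      have ABN: "A \<noteq> 0" "B \<noteq> 0" "N \<noteq> 0"
        unfolding A_def B_def N_def by (intro qpoch_nonzero p q')+
      have nx: "1 - p * x \<noteq> 0" "1 - p ^ 2 * x \<noteq> 0" "1 - p ^ 3 * x * w ^ 2 \<noteq> 0" "1 + q * p * x * w \<noteq> 0"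
        using nz[of r] nz[of "Suc r"] nz[of "2 * k + r + 2"] nq[of "k + Suc r"]
        by (auto simp: x_def w_def power2_eq_square mult_2 mult_2_right power_add eval_nat_numeral mult_ac)
      have e: "p ^ Suc r = p * x" "p ^ Suc (Suc r) = p ^ 2 * x" "p ^ Suc k = p * w"
        by (simp_all add: x_def w_def power2_eq_square mult_ac)
      have pA: "qpoch p p (Suc r) = A * (1 - p * x)"
        "qpoch p p (Suc (Suc r)) = A * (1 - p * x) * (1 - p ^ 2 * x)"
        by (simp_all add: qpoch_self_Suc A_def x_def eval_nat_numeral mult_ac)
      have pB: "qpoch p p (2 * Suc k + r + 1) = B * (1 - p ^ 3 * x * w ^ 2)"
        "qpoch p p (2 * k + Suc (Suc r) + 1) = B * (1 - p ^ 3 * x * w ^ 2)"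
        by (simp_all add: qpoch_self_Suc B_def x_def w_def power2_eq_square mult_2 mult_2_right power_add
            eval_nat_numeral mult_ac)
      have pN: "qpoch (-q) p (Suc k + r) = N" "qpoch (-q) p (k + Suc (Suc r)) = N * (1 + q * p * x * w)"
        "qpoch (-q) p (k + Suc r + 1) = N * (1 + q * p * x * w)"
        "qpoch (-q) p (Suc k + r + 1) = N * (1 + q * p * x * w)"
        by (simp_all add: qpoch_Suc N_def x_def w_def power_add mult_ac)
      have i: "Suc k + r = k + Suc r"
        by simp
      have "qpoch p p (Suc (Suc (2 * (k + Suc r)))) =
          Q * (1 - p * p ^ (2 * (k + Suc r))) * (1 - p * (p * p ^ (2 * (k + Suc r))))"
        by (simp only: qpoch_self_Suc Q_def power_Suc)
      moreover have e2: "p ^ (2 * (k + Suc r)) = p ^ 2 * x ^ 2 * w ^ 2"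
        by (simp add: x_def w_def power2_eq_square mult_2 mult_2_right power_add mult_ac)
      moreover have "Suc (Suc (2 * (k + Suc r))) = 2 * (k + Suc (Suc r))"
        by simp
      ultimately have pQ: "qpoch p p (2 * (k + Suc (Suc r))) =
          Q * (1 - p ^ 3 * x ^ 2 * w ^ 2) * (1 - p ^ 4 * x ^ 2 * w ^ 2)"
        by (simp only: e2) (simp add: eval_nat_numeral mult_ac)
      have pQ': "qpoch p p (2 * (Suc k + r)) = Q"
        unfolding Q_def i ..
      have d: "1 - p ^ 3 * x ^ 2 * w ^ 2 = (1 - q * p * x * w) * (1 + q * p * x * w)"
        unfolding p_def by algebra
      show ?thesis
        unfolding T_def U_def qw e pA pB pN pQ pQ' N_def[symmetric] A_def[symmetric] B_def[symmetric]
          Q_def[symmetric] x_def[symmetric] w_def[symmetric] d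
        \<comment> \<open>The remaining polynomial identity holds only modulo the relation between
          \<open>p\<close> and \<open>q\<close>, which is therefore passed on.\<close>
        using ABN nx apply (simp add: divide_simps)
        using p_def by algebra
    qed
    show "partial_theta 1 q k = 1 + q ^ (2 * k + 3) * partial_theta 1 q (Suc k)" for k
      using partial_theta_rec[OF q, of "1" k] by simp
    show "norm (partial_theta 1 q k) \<le> 1 / (1 - norm q)" for k
      using q by (intro partial_theta_bounded) auto
    show "norm (q ^ (2 * k + 3)) \<le> norm q" for k
      using norm_power_le_power[OF q, of 1 "2 * k + 3"] by simp
  qed (use q in auto)
  then show ?thesis
    unfolding T_def C_def .
qed

text \<open>The exponent is \<open>(r + 2 * k + 2 choose 2) - (2 * k + 2 choose 2)\<close>. For
  nonzero \<open>q\<close> this is the tail from \<open>n = 2 * k + 2\<close> of the series with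
  terms \<open>q ^ (n choose 2)\<close>, divided by its first term.\<close>

definition half_theta :: "complex \<Rightarrow> nat \<Rightarrow> complex" where
  "half_theta q k = (\<Sum>r. q ^ ((r choose 2) + 2 * (k + 1) * r))"

lemma half_theta_term_bound:
  fixes q :: complex
  assumes "norm q < 1"
  shows "norm (q ^ ((r choose 2) + 2 * (k + 1) * r)) \<le> norm q ^ r"
  by (intro norm_power_le_power assms) (simp add: trans_le_add2)

lemma half_theta_bounded:
  assumes "norm q < 1"
  shows "norm (half_theta q k) \<le> 1 / (1 - norm q)"
  unfolding half_theta_def
  using half_theta_term_bound[OF assms] assms by (intro norm_suminf_le_geometric) auto

text \<open>Raising \<open>k\<close> by one moves the start of the tail by two places, so two terms
  split off.\<close>

lemma half_theta_rec:
  assumes "norm q < 1"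
  shows "half_theta q k = 1 + q ^ (2 * k + 2) + q ^ (4 * k + 5) * half_theta q (Suc k)"
proof -
  define f where "f k r = q ^ ((r choose 2) + 2 * (k + 1) * r)" for k r
  have sum: "summable (f k)" for k
    unfolding f_def using half_theta_term_bound[OF assms] assms
    by (intro norm_suminf_le_geometric(1)) auto
  have "f k (Suc (Suc r)) = q ^ (4 * k + 5) * f (Suc k) r" for r
  proof -
    have "(Suc (Suc r) choose 2) + 2 * (k + 1) * Suc (Suc r) =
        (4 * k + 5) + ((r choose 2) + 2 * (Suc k + 1) * r)"
      by (simp add: choose_two_Suc algebra_simps)
    then show ?thesis
      unfolding f_def by (simp only: power_add mult_ac)
  qed
  then have "(\<Sum>r. f k (Suc (Suc r))) = q ^ (4 * k + 5) * (\<Sum>r. f (Suc k) r)"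
    using sum by (simp add: suminf_mult)
  moreover have "half_theta q k = suminf (f k)" for k
    unfolding half_theta_def f_def ..
  moreover have "f k 0 = 1" "f k (Suc 0) = q ^ (2 * k + 2)"
    by (simp_all add: f_def numeral_2_eq_2)
  moreover have "(\<Sum>r. f k (Suc (Suc r))) = suminf (f k) - f k 0 - f k (Suc 0)"
    using suminf_split_head[OF sum, of k] suminf_split_head[of "\<lambda>r. f k (Suc r)"] sum[of k]
    by (simp add: summable_Suc_iff)
  ultimately show ?thesis
    by (simp add: algebra_simps)
qed

text \<open>Creative telescoping again; the two terms split off from \<open>half_theta\<close> now
  form a limit that depends on \<open>k\<close>.\<close>

lemma theta_sum_L7:
  fixes q :: complex
  assumes q: "norm q < 1"
  defines "p \<equiv> q\<^sup>2"
  shows "(\<lambda>r. qpoch_inf p p * qpoch_inf (-q) q * (1 - q ^ (2 * k + 1)) *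
           (p ^ r * qpoch q q (2 * (k + r)) / (qpoch p p r * qpoch p p (2 * k + r + 1))))
         sums half_theta q k"
proof -
  define C where "C = qpoch_inf p p * qpoch_inf (-q) q"
  have p: "norm p < 1"
    using q by (simp add: p_def norm_power power_less_one_iff)
  note nz = one_minus_power_Suc_nonzero[OF p]
  define T where "T k r = C * (1 - q ^ (2 * k + 1)) *
      (p ^ r * qpoch q q (2 * (k + r)) / (qpoch p p r * qpoch p p (2 * k + r + 1)))" for k r
  \<comment> \<open>Here \<open>1 - q ^ (2 * k + 1)\<close> is exchanged for
    \<open>1 + q ^ (2 * k + 2)\<close>, the inhomogeneous term of \<open>half_theta_rec\<close>, and
    \<open>p ^ r\<close> for \<open>1 - p ^ r\<close>.\<close>
  define U where "U k r = C * ((1 + q ^ (2 * k + 2)) * (1 - p ^ r) * qpoch q q (2 * (k + r)) /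
      (qpoch p p r * qpoch p p (2 * k + r + 1)))" for k r
  obtain M1 where M1: "M1 > 0" "\<And>n. norm (qpoch q q n) \<le> M1"
    using qpoch_bounded[OF q] by blast
  obtain M2 where M2: "M2 > 0" "\<And>n. norm (inverse (qpoch p p n)) \<le> M2"
    using inverse_qpoch_bounded[OF p p] by blast
  have qw: "q ^ (2 * k + 1) = q * p ^ k" "q ^ (2 * k + 2) = p * p ^ k"
      "q ^ (4 * k + 5) = q * p ^ 2 * (p ^ k) ^ 2" for k
    by (simp_all add: p_def power_mult_distrib mult_2 power_add power2_eq_square eval_nat_numeral mult_ac)
  have "T k sums half_theta q k" for k
  proof (rule sums_of_telescoping_recurrence[where U = U and L = "\<lambda>k. 1 + q ^ (2 * k + 2)"
        and b = "\<lambda>k. q ^ (4 * k + 5)" and c = "norm q"])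
    show "norm (T k r) \<le> norm C * 2 * M1 * M2 * M2 * norm q ^ r" for k r
    proof -
      have "norm (1 - q ^ (2 * k + 1)) \<le> 1 + norm (q ^ (2 * k + 1))"
        using norm_triangle_ineq4[of 1 "q ^ (2 * k + 1)"] by simp
      also have "\<dots> \<le> 2"
        using norm_power_le_power[OF q, of 0 "2 * k + 1"] by simp
      finally have two: "norm (1 - q ^ (2 * k + 1)) \<le> 2" .
      have pr: "norm (p ^ r) \<le> norm q ^ r"
        unfolding p_def power_square_double by (intro norm_power_le_power q) simp
      have "norm (T k r) = norm C * norm (1 - q ^ (2 * k + 1)) * norm (qpoch q q (2 * (k + r)))
          * norm (inverse (qpoch p p r))
          * norm (inverse (qpoch p p (2 * k + r + 1))) * norm (p ^ r)"
        unfolding T_def divide_inverse norm_mult inverse_mult_distrib by (simp only: mult_ac)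
      also have "\<dots> \<le> norm C * 2 * M1 * M2 * M2 * norm q ^ r"
        using M1 M2 by (intro mult_mono order_refl two pr) auto
      finally show ?thesis .
    qed
    have nzi: "qpoch_inf p p \<noteq> 0"
      by (intro qpoch_inf_nonzero p)
    have "(\<lambda>r. U k r) \<longlonglongrightarrow> C * ((1 + q ^ (2 * k + 2)) * (1 - 0) * qpoch_inf q q /
        (qpoch_inf p p * qpoch_inf p p))" for k
      unfolding U_def
      by (intro tendsto_intros qpoch_LIMSEQ_compose LIMSEQ_power_zero p q qpoch_LIMSEQ)
         (use nzi in \<open>auto simp: strict_mono_def\<close>)
    moreover have "C * ((1 + q ^ (2 * k + 2)) * (1 - 0) * qpoch_inf q q /
        (qpoch_inf p p * qpoch_inf p p)) = 1 + q ^ (2 * k + 2)" for k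
    proof -
      have "C * ((1 + q ^ (2 * k + 2)) * (1 - 0) * qpoch_inf q q / (qpoch_inf p p * qpoch_inf p p)) =
          (qpoch_inf p p * (qpoch_inf q q * qpoch_inf (-q) q)) * (1 + q ^ (2 * k + 2))
            / (qpoch_inf p p * qpoch_inf p p)"
        by (simp add: C_def mult_ac)
      then show ?thesis
        using nzi unfolding qpoch_inf_mult_minus[OF q] p_def by simp
    qed
    ultimately show "U k \<longlonglongrightarrow> 1 + q ^ (2 * k + 2)" for k
      by simp
    show "T k 0 = U k 1" for k
    proof -
      define w Q R where "w = p ^ k" and "Q = qpoch q q (2 * k)" and "R = qpoch p p (2 * k + 1)"
      have nw: "1 - p ^ 2 * w ^ 2 \<noteq> 0" "1 - p \<noteq> 0" "R \<noteq> 0"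
        using nz[of "2 * k + 1"] nz[of 0] qpoch_nonzero[OF p p]
        by (auto simp: w_def R_def power2_eq_square mult_2 mult_2_right power_add mult_ac)
      have e: "qpoch p p (2 * k + 1 + 1) = R * (1 - p ^ 2 * w ^ 2)"
        by (simp add: qpoch_self_Suc R_def w_def power2_eq_square mult_2 mult_2_right power_add mult_ac)
      have "qpoch q q (2 * (k + 1)) = Q * (1 - q ^ (2 * k + 1)) * (1 - q ^ (2 * k + 2))"
        by (simp add: qpoch_self_Suc Q_def)
      then have e': "qpoch q q (2 * (k + 1)) = Q * (1 - q * w) * (1 - p * w)"
        unfolding qw w_def[symmetric] .
      have e1: "qpoch p p 1 = 1 - p" "qpoch p p 0 = 1"
        by (simp_all add: qpoch_def)
      have "T k 0 = C * (1 - q * w) * (Q / R)"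
        unfolding T_def qw add_0_right e1 Q_def[symmetric] R_def[symmetric] w_def[symmetric] by simp
      also have "\<dots> = C * ((1 + p * w) * (1 - p) * (Q * (1 - q * w) * (1 - p * w)) / ((1 - p) * (R * (1 - p ^ 2 * w ^ 2))))"
        using nw by (simp add: divide_simps) algebra
      also have "\<dots> = U k 1"
        unfolding U_def qw e e' e1 w_def[symmetric] by simp
      finally show ?thesis .
    qed
    show "T k (Suc r) - q ^ (4 * k + 5) * T (Suc k) r = U k (Suc (Suc r)) - U k (Suc r)" for k r
    proof -
      define x w Q A B where "x = p ^ r" and "w = p ^ k"
        and "Q = qpoch q q (2 * (k + Suc r))"
        and "A = qpoch p p r" and "B = qpoch p p (2 * k + Suc r + 1)"
      have AB: "A \<noteq> 0" "B \<noteq> 0"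
        unfolding A_def B_def by (intro qpoch_nonzero p)+
      have nx: "1 - p * x \<noteq> 0" "1 - p ^ 2 * x \<noteq> 0" "1 - p ^ 3 * x * w ^ 2 \<noteq> 0"
        using nz[of r] nz[of "Suc r"] nz[of "2 * k + r + 2"]
        by (auto simp: x_def w_def power2_eq_square mult_2 mult_2_right power_add eval_nat_numeral mult_ac)
      have e: "p ^ Suc r = p * x" "p ^ Suc (Suc r) = p ^ 2 * x" "p ^ Suc k = p * w"
        by (simp_all add: x_def w_def power2_eq_square mult_ac)
      have pA: "qpoch p p (Suc r) = A * (1 - p * x)"
        "qpoch p p (Suc (Suc r)) = A * (1 - p * x) * (1 - p ^ 2 * x)"
        by (simp_all add: qpoch_self_Suc A_def x_def eval_nat_numeral mult_ac)
      have pB: "qpoch p p (2 * Suc k + r + 1) = B * (1 - p ^ 3 * x * w ^ 2)"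
        "qpoch p p (2 * k + Suc (Suc r) + 1) = B * (1 - p ^ 3 * x * w ^ 2)"
        by (simp_all add: qpoch_self_Suc B_def x_def w_def power2_eq_square mult_2 mult_2_right power_add
            eval_nat_numeral mult_ac)
      have i: "Suc k + r = k + Suc r"
        by simp
      have "qpoch q q (Suc (Suc (2 * (k + Suc r)))) =
          Q * (1 - q * q ^ (2 * (k + Suc r))) * (1 - q * (q * q ^ (2 * (k + Suc r))))"
        by (simp only: qpoch_self_Suc Q_def power_Suc)
      moreover have "q ^ (2 * (k + Suc r)) = p * x * w"
        unfolding power_square_double[symmetric] p_def[symmetric]
        by (simp add: x_def w_def power_add mult_ac)
      moreover have "q * (q * (p * x * w)) = p * p * x * w"
        by (simp add: p_def power2_eq_square mult_ac)
      ultimately have pQ: "qpoch q q (2 * (k + Suc (Suc r))) =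
          Q * (1 - q * p * x * w) * (1 - p * p * x * w)"
        by (simp add: mult_ac)
      have pQ': "qpoch q q (2 * (Suc k + r)) = Q"
        unfolding Q_def i ..
      show ?thesis
        unfolding T_def U_def qw e pA pB pQ pQ' A_def[symmetric] B_def[symmetric]
          Q_def[symmetric] x_def[symmetric] w_def[symmetric]
        using AB nx apply (simp add: divide_simps)
        using p_def by algebra
    qed
    show "half_theta q k = 1 + q ^ (2 * k + 2) + q ^ (4 * k + 5) * half_theta q (Suc k)" for k
      by (rule half_theta_rec[OF q])
    show "norm (half_theta q k) \<le> 1 / (1 - norm q)" for k
      by (rule half_theta_bounded[OF q])
    show "norm (q ^ (4 * k + 5)) \<le> norm q" for k
      using norm_power_le_power[OF q, of 1 "4 * k + 5"] by simp
  qed (use q in auto)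
  then show ?thesis
    unfolding T_def C_def .
qed

subsection \<open>Rearrangement of double series\<close>

text \<open>A majorant in product form gives absolute summability, which justifies the reorderings
  of double series below.\<close>

lemma summable_on_product_bound:
  fixes f :: "nat \<Rightarrow> 'b \<Rightarrow> complex"
  assumes a: "summable a" "\<And>m. 0 \<le> a m" and b: "b summable_on UNIV" "\<And>n. 0 \<le> b n"
    and f: "\<And>m n. norm (f m n) \<le> a m * b n"
  shows "(\<lambda>(m, n). f m n) summable_on UNIV"
proof -
  have "(\<lambda>(m, n). a m * b n) summable_on UNIV \<times> UNIV"
  proof (rule summable_on_SigmaI)
    show "((\<lambda>n. case (m, n) of (m, n) \<Rightarrow> a m * b n) has_sum a m * infsum b UNIV) UNIV" for m
      using has_sum_cmult_right[OF has_sum_infsum[OF b(1)], of "a m"] by simp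
    have "a summable_on UNIV"
      using a by (intro norm_summable_imp_summable_on) simp
    then show "(\<lambda>m. a m * infsum b UNIV) summable_on UNIV"
      by (rule summable_on_cmult_left)
  qed (use a b in auto)
  then have "(\<lambda>x. norm (case x of (m, n) \<Rightarrow> f m n)) summable_on UNIV"
    using f by (intro Infinite_Sum.abs_summable_on_comparison_test'[where g = "\<lambda>(m, n). a m * b n"]) auto
  then show ?thesis
    by (rule abs_summable_summable)
qed

text \<open>The family is regrouped along the levels \<open>j = m + w n\<close>. The weight is
  \<open>\<bar>n\<bar>\<close> or \<open>2 * \<bar>n\<bar>\<close> for the double sums of the
  theorem, and the index itself for the triangular sums of the Bailey transform.\<close>

lemma level_sums:
  fixes f :: "nat \<Rightarrow> 'b \<Rightarrow> complex" and w :: "'b \<Rightarrow> nat"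
  assumes f: "((\<lambda>(m, n). f m n) has_sum S) UNIV"
    and A: "\<And>j. finite (A j)" "\<And>j n. n \<in> A j \<longleftrightarrow> w n \<le> j"
  shows "(\<lambda>j. \<Sum>n\<in>A j. f (j - w n) n) sums S"
proof -
  have bij: "bij_betw (\<lambda>(j, n). (j - w n, n)) (Sigma UNIV A) UNIV"
    by (rule bij_betw_byWitness[where f' = "\<lambda>(m, n). (m + w n, n)"]) (auto simp: A(2))
  have "((\<lambda>x. case (case x of (j, n) \<Rightarrow> (j - w n, n)) of (m, n) \<Rightarrow> f m n) has_sum S) (Sigma UNIV A)"
    using has_sum_reindex_bij_betw[OF bij, of "\<lambda>(m, n). f m n" S] f by simp
  then have "((\<lambda>j. \<Sum>n\<in>A j. f (j - w n) n) has_sum S) UNIV"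
    by (rule has_sum_SigmaD) (simp add: A(1) has_sum_finite)
  then show ?thesis
    by (rule has_sum_imp_sums)
qed

text \<open>Splitting at 0 matches \<open>r\<close> with \<open>- (r + 1)\<close>, the pairing under
  which the two summands of the theorem differ by a factor independent of \<open>r\<close>.\<close>

lemma has_sum_int_split:
  fixes f :: "int \<Rightarrow> 'a :: banach"
  assumes "((\<lambda>r. f (int r)) has_sum A) UNIV" "((\<lambda>r. f (- int (Suc r))) has_sum B) UNIV"
  shows "(f has_sum (A + B)) UNIV"
proof -
  have "(f has_sum A) (range int)"
    using assms(1) by (subst has_sum_reindex) (auto simp: o_def)
  moreover have "(f has_sum B) (range (\<lambda>r. - int (Suc r)))"
    using assms(2) by (subst has_sum_reindex) (auto simp: o_def inj_on_def)
  ultimately have "(f has_sum (A + B)) (range int \<union> range (\<lambda>r. - int (Suc r)))"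
    by (rule has_sum_Un_disjoint) auto
  moreover have "range int \<union> range (\<lambda>r. - int (Suc r)) = UNIV"
  proof -
    have "n \<in> range int \<union> range (\<lambda>r. - int (Suc r))" for n
      by (cases n) auto
    then show ?thesis
      by blast
  qed
  ultimately show ?thesis
    by simp
qed

section \<open>Growth of the centred monomials and absolute convergence\<close>

definition centred_monomial :: "complex \<Rightarrow> nat \<Rightarrow> complex" where
  "centred_monomial z k = inverse z ^ k + z ^ Suc k - z - 1"

lemma norm_centred_monomial_le:
  defines "R z \<equiv> 1 + norm z + norm (inverse z)"
  shows "norm (centred_monomial z k) \<le> (2 + 2 * R z) * R z ^ k"
proof -
  have R: "1 \<le> R z" "norm z \<le> R z" "norm (inverse z) \<le> R z"
    by (simp_all add: R_def)
  have R': "1 \<le> R z ^ k" "0 \<le> R z"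
    using R(1) by (simp_all add: one_le_power)
  have "norm (centred_monomial z k) \<le> norm (inverse z ^ k) + norm (z ^ Suc k) + norm z + norm (1 :: complex)"
    unfolding centred_monomial_def
    by (intro order_trans[OF norm_triangle_ineq4] add_mono order_refl norm_triangle_ineq)
  also have "\<dots> \<le> R z ^ k + R z * R z ^ k + R z * R z ^ k + R z ^ k"
  proof (intro add_mono)
    show "norm (inverse z ^ k) \<le> R z ^ k"
      unfolding norm_power using R by (intro power_mono) auto
    show "norm (z ^ Suc k) \<le> R z * R z ^ k"
      unfolding norm_power power_Suc[symmetric] using R by (intro power_mono) auto
    show "norm z \<le> R z * R z ^ k"
      using mult_mono[OF R(2) R'(1)] R'(2) by simp
    show "norm (1 :: complex) \<le> R z ^ k"
      using R' by simp
  qed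
  also have "\<dots> = (2 + 2 * R z) * R z ^ k"
    by (simp add: algebra_simps)
  finally show ?thesis .
qed

text \<open>Consecutive terms have ratio \<open>c ^ k * R\<close>, which tends to 0: quadratic
  exponents beat every geometric growth.\<close>

lemma summable_choose_two_geometric:
  fixes c R :: real
  assumes c: "0 \<le> c" "c < 1" and R: "0 \<le> R"
  shows "summable (\<lambda>k. c ^ (k choose 2) * R ^ k)"
proof -
  have "(\<lambda>k. c ^ k * R) \<longlonglongrightarrow> 0 * R"
    using c by (intro tendsto_intros LIMSEQ_realpow_zero)
  then have "eventually (\<lambda>k. c ^ k * R < 1 / 2) sequentially"
    by (rule order_tendstoD) simp
  then obtain N where N: "\<And>k. k \<ge> N \<Longrightarrow> c ^ k * R < 1 / 2"
    by (auto simp: eventually_at_top_linorder)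
  show ?thesis
  proof (rule summable_ratio_test[where c = "1 / 2" and N = N])
    fix k
    assume "N \<le> k"
    have "c ^ (Suc k choose 2) * R ^ Suc k = (c ^ k * R) * (c ^ (k choose 2) * R ^ k)"
      by (simp add: choose_two_Suc power_add mult_ac)
    also have "\<dots> \<le> 1 / 2 * (c ^ (k choose 2) * R ^ k)"
      using N[OF \<open>N \<le> k\<close>] c R by (intro mult_right_mono) auto
    finally show "norm (c ^ (Suc k choose 2) * R ^ Suc k) \<le> 1 / 2 * norm (c ^ (k choose 2) * R ^ k)"
      using c R by simp
  qed simp
qed

lemma summable_centred_monomial:
  fixes c :: real
  assumes c: "0 \<le> c" "c < 1"
  shows "summable (\<lambda>k. c ^ (k choose 2) * norm (centred_monomial z k))"
proof -
  define R where "R = 1 + norm z + norm (inverse z)"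
  have "0 \<le> R"
    by (simp add: R_def)
  then have "summable (\<lambda>k. (2 + 2 * R) * (c ^ (k choose 2) * R ^ k))"
    by (intro summable_mult summable_choose_two_geometric c)
  then show ?thesis
  proof (rule summable_comparison_test')
    show "norm (c ^ (k choose 2) * norm (centred_monomial z k)) \<le> (2 + 2 * R) * (c ^ (k choose 2) * R ^ k)" for k
      using mult_left_mono[OF norm_centred_monomial_le[of z k], of "c ^ (k choose 2)"] c
      by (simp add: R_def mult_ac)
  qed
qed

text \<open>Both sides sum one absolutely summable family over pairs \<open>(m, n)\<close>: the left
  groups it by \<open>j = m + w n\<close>, the right sums over \<open>n\<close> first.\<close>

lemma indefinite_sum_eq:
  fixes G :: "nat \<Rightarrow> int \<Rightarrow> complex" and w :: "int \<Rightarrow> nat" and c :: real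
  assumes c: "0 \<le> c" "c < 1"
    and G: "\<And>m r. norm (G m (int r)) \<le> c ^ (m choose 2) * c ^ r"
      "\<And>m r. norm (G m (- int (Suc r))) \<le> c ^ (m choose 2) * c ^ r"
    and A: "\<And>j. finite (A j)" "\<And>j n. n \<in> A j \<longleftrightarrow> w n \<le> j"
  shows "(\<Sum>j. \<Sum>n\<in>A j. centred_monomial z (j - w n) * G (j - w n) n) =
     (\<Sum>m. centred_monomial z m * (\<Sum>r. G m (int r) + G m (- int (Suc r))))"
proof -
  \<comment> \<open>A majorant on the integers whose value at both \<open>r\<close> and
    \<open>- (r + 1)\<close> is \<open>c ^ r\<close>.\<close>
  define b :: "int \<Rightarrow> real" where "b n = (if n \<ge> 0 then c ^ nat n else c ^ nat (- n - 1))" for n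
  have geo: "summable (\<lambda>r. norm (c ^ r))"
    using c by (simp add: summable_geometric)
  have hg: "((\<lambda>r. c ^ r) has_sum (\<Sum>r. c ^ r)) UNIV"
    using geo c by (intro norm_summable_imp_has_sum) (auto intro: summable_sums summable_geometric)
  have "(b has_sum ((\<Sum>r. c ^ r) + (\<Sum>r. c ^ r))) UNIV"
    by (rule has_sum_int_split) (use hg in \<open>simp_all add: b_def\<close>)
  then have b: "b summable_on UNIV"
    by (rule has_sum_imp_summable)
  have Gb: "norm (G m n) \<le> c ^ (m choose 2) * b n" for m n
    using G[of m] by (cases n) (auto simp: b_def)
  have fsum: "(\<lambda>(m, n). centred_monomial z m * G m n) summable_on UNIV"
  proof (rule summable_on_product_bound[where b = b])
    show "norm (centred_monomial z m * G m n) \<le> (c ^ (m choose 2) * norm (centred_monomial z m)) * b n" for m n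
      using mult_left_mono[OF Gb, of "norm (centred_monomial z m)" m n] by (simp add: norm_mult mult_ac)
  qed (use summable_centred_monomial[OF c] c b in \<open>auto simp: b_def\<close>)
  define S where "S = infsum (\<lambda>(m, n). centred_monomial z m * G m n) UNIV"
  have S: "((\<lambda>(m, n). centred_monomial z m * G m n) has_sum S) (UNIV \<times> UNIV)"
    unfolding S_def using fsum by simp
  have "(G m has_sum (\<Sum>r. G m (int r) + G m (- int (Suc r)))) UNIV" for m
  proof -
    have bd: "summable (\<lambda>r. c ^ (m choose 2) * c ^ r)"
      using c by (intro summable_mult summable_geometric) simp
    have n: "summable (\<lambda>r. norm (G m (int r)))" "summable (\<lambda>r. norm (G m (- int (Suc r))))"
      using G by (intro summable_comparison_test'[OF bd]; simp)+
    note s = n[THEN summable_norm_cancel]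
    have "(G m has_sum ((\<Sum>r. G m (int r)) + (\<Sum>r. G m (- int (Suc r))))) UNIV"
      by (intro has_sum_int_split norm_summable_imp_has_sum n summable_sums s)
    then show ?thesis
      by (simp only: suminf_add[OF s])
  qed
  then have "((\<lambda>m. centred_monomial z m * (\<Sum>r. G m (int r) + G m (- int (Suc r)))) has_sum S) UNIV"
    by (intro has_sum_SigmaD[OF S]) (simp add: has_sum_cmult_right)
  then have "(\<lambda>m. centred_monomial z m * (\<Sum>r. G m (int r) + G m (- int (Suc r)))) sums S"
    by (rule has_sum_imp_sums)
  moreover have "(\<lambda>j. \<Sum>n\<in>A j. centred_monomial z (j - w n) * G (j - w n) n) sums S"
    using S by (intro level_sums A) simp
  ultimately show ?thesis
    by (simp add: sums_iff)
qed

text \<open>With \<open>n = k + r\<close> and up to the factor \<open>q ^ k\<close>, this is the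
  conjugate Bailey sum of \<open>q ^ n * \<beta> n * qpoch q q (2 * n)\<close> over
  \<open>qpoch q q (n - k) * qpoch q q (n + k + 1)\<close>. The missing \<open>q ^ k\<close> turns
  \<open>k choose 2\<close> into \<open>Suc k choose 2\<close> in the transform.\<close>

definition bailey_sum :: "complex \<Rightarrow> (nat \<Rightarrow> complex) \<Rightarrow> nat \<Rightarrow> complex" where
  "bailey_sum q \<beta> k =
     (\<Sum>r. q ^ r * \<beta> (k + r) * qpoch q q (2 * (k + r)) / (qpoch q q r * qpoch q q (2 * k + r + 1)))"

text \<open>The centred expansion is inserted into the series over \<open>n\<close> and the order of
  summation is exchanged, so that each centred monomial collects one coefficient sum.\<close>

lemma bailey_transform:
  fixes q z :: complex and \<beta> :: "nat \<Rightarrow> complex"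
  assumes q: "norm q < 1" and z: "z \<noteq> 0" "z \<noteq> - 1" and \<beta>: "\<And>n. norm (\<beta> n) \<le> M"
  shows "(\<lambda>k. centred_monomial z k *
            ((-1) ^ k * q ^ (Suc k choose 2) * (1 - q ^ (2 * k + 1)) * bailey_sum q \<beta> k)) sums
         ((1 + z) * (\<Sum>n. qpoch z q (Suc n) * qpoch (inverse z) q (Suc n) * q ^ Suc n * \<beta> (Suc n)))"
    (is "?F sums _")
proof -
  have nz: "1 + z \<noteq> 0"
    using z(2) by (simp add: add_eq_0_iff)
  define h where "h k r = q ^ r * \<beta> (k + r) * qpoch q q (2 * (k + r)) / (qpoch q q r * qpoch q q (2 * k + r + 1))"
    for k r
  define f where "f r k = laurent_coeff q (k + r) k * centred_monomial z k * (q ^ (k + r) * \<beta> (k + r))"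
    for r k
  define g where "g k = centred_monomial z k * ((-1) ^ k * q ^ (Suc k choose 2) * (1 - q ^ (2 * k + 1)))" for k
  \<comment> \<open>The summand separates into a part in \<open>k\<close> with quadratic exponents
    and a part that decays geometrically in \<open>r\<close>, uniformly in \<open>k\<close>.\<close>
  have fh: "f r k = g k * h k r" for r k
    unfolding f_def g_def h_def laurent_coeff_add
    by (simp add: choose_two_Suc power_add divide_inverse mult_ac)
  obtain M1 where M1: "M1 > 0" "\<And>n. norm (qpoch q q n) \<le> M1"
    using qpoch_bounded[OF q] by blast
  obtain M2 where M2: "M2 > 0" "\<And>n. norm (inverse (qpoch q q n)) \<le> M2"
    using inverse_qpoch_bounded[OF q q] by blast
  have M: "0 \<le> M"
    using \<beta>[of 0] norm_ge_zero order_trans by blast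
  define K where "K = M * M1 * M2 * M2"
  have K: "0 \<le> K"
    using M M1 M2 by (simp add: K_def)
  have h: "norm (h k r) \<le> K * norm q ^ r" for k r
  proof -
    have "norm (h k r) = norm (\<beta> (k + r)) * norm (qpoch q q (2 * (k + r))) * norm (inverse (qpoch q q r))
        * norm (inverse (qpoch q q (2 * k + r + 1))) * norm q ^ r"
      unfolding h_def divide_inverse norm_mult inverse_mult_distrib norm_power by (simp only: mult_ac)
    also have "\<dots> \<le> K * norm q ^ r"
      unfolding K_def using M1 M2 \<beta> M by (intro mult_mono order_refl) auto
    finally show ?thesis .
  qed
  have g: "norm (g k) \<le> 2 * (norm q ^ (k choose 2) * norm (centred_monomial z k))" for k
  proof -
    have "norm (1 - q ^ (2 * k + 1)) \<le> 1 + norm (q ^ (2 * k + 1))"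
      using norm_triangle_ineq4[of 1 "q ^ (2 * k + 1)"] by simp
    also have "\<dots> \<le> 2"
      using norm_power_le_power[OF q, of 0 "2 * k + 1"] by simp
    finally have two: "norm (1 - q ^ (2 * k + 1)) \<le> 2" .
    have "norm (g k) = norm (centred_monomial z k) * (norm (q ^ (Suc k choose 2)) * norm (1 - q ^ (2 * k + 1)))"
      by (simp add: g_def norm_mult norm_power)
    also have "\<dots> \<le> norm (centred_monomial z k) * (norm q ^ (k choose 2) * 2)"
      by (intro mult_mono two norm_power_le_power q order_refl) (auto simp: choose_two_Suc)
    finally show ?thesis
      by (simp add: mult_ac)
  qed
  have geo: "summable (\<lambda>r. K * norm q ^ r)"
    using q by (intro summable_mult summable_geometric) simp
  have fsum: "(\<lambda>(r, k). f r k) summable_on UNIV"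
  proof (rule summable_on_product_bound[OF geo])
    show "(\<lambda>k. 2 * (norm q ^ (k choose 2) * norm (centred_monomial z k))) summable_on UNIV"
      using summable_centred_monomial[of "norm q" z] q
      by (intro norm_summable_imp_summable_on) (simp add: summable_mult)
    show "norm (f r k) \<le> K * norm q ^ r * (2 * (norm q ^ (k choose 2) * norm (centred_monomial z k)))" for r k
      unfolding fh norm_mult using mult_mono[OF h[of k r] g[of k]] K by (simp add: mult_ac)
  qed (use K in auto)
  define S where "S = infsum (\<lambda>(r, k). f r k) UNIV"
  have S: "((\<lambda>(r, k). f r k) has_sum S) UNIV"
    unfolding S_def using fsum by simp
  have "(\<lambda>n. \<Sum>k\<in>{..n}. f (n - k) k) sums S"
    by (rule level_sums[OF S]) auto
  \<comment> \<open>At \<open>n = 0\<close> the only centred monomial is that of index 0, which is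
    0; hence the series starts at 1.\<close>
  moreover have "(\<Sum>k\<in>{..n}. f (n - k) k) =
     (if n = 0 then 0 else (1 + z) * (qpoch z q n * qpoch (inverse z) q n * q ^ n * \<beta> n))" for n
  proof -
    have "(\<Sum>k\<in>{..n}. f (n - k) k) =
        (\<Sum>k\<le>n. laurent_coeff q n k * centred_monomial z k) * (q ^ n * \<beta> n)"
      unfolding f_def sum_distrib_right by (intro sum.cong) auto
    then show ?thesis
      using qpoch_product_expansion_centred[OF q z(1), of n]
      by (cases "n = 0") (simp_all add: centred_monomial_def mult_ac)
  qed
  ultimately have "(\<lambda>n. if n = 0 then 0 else (1 + z) * (qpoch z q n * qpoch (inverse z) q n * q ^ n * \<beta> n)) sums S"
    by simp
  then have "(\<lambda>n. (1 + z) * (qpoch z q (Suc n) * qpoch (inverse z) q (Suc n) * q ^ Suc n * \<beta> (Suc n))) sums S"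
    using sums_Suc_iff[of "\<lambda>n. if n = 0 then 0 else (1 + z) * (qpoch z q n * qpoch (inverse z) q n * q ^ n * \<beta> n)" S]
    by simp
  note S_sums = this
  \<comment> \<open>Summability of the series without \<open>1 + z\<close> follows from that of the
    scaled one, because \<open>1 + z\<close> is nonzero.\<close>
  have S_eq: "(1 + z) * (\<Sum>n. qpoch z q (Suc n) * qpoch (inverse z) q (Suc n) * q ^ Suc n * \<beta> (Suc n)) = S"
    using sums_unique[OF S_sums] suminf_mult[OF summable_mult_D[OF sums_summable[OF S_sums] nz], of "1 + z"]
    by (simp only:)
  have bij_swap: "bij_betw prod.swap UNIV (UNIV :: (nat \<times> nat) set)"
    by (rule bij_betw_byWitness[where f' = prod.swap]) auto
  have "((\<lambda>(k, r). f r k) has_sum S) (UNIV \<times> UNIV)"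
    using has_sum_reindex_bij_betw[OF bij_swap, of "\<lambda>(r, k). f r k" S] S
    by (simp add: case_prod_unfold)
  moreover have "((\<lambda>r. case (k, r) of (k, r) \<Rightarrow> f r k) has_sum (g k * bailey_sum q \<beta> k)) UNIV" for k
  proof -
    have n: "summable (\<lambda>r. norm (h k r))"
      using h by (intro summable_comparison_test'[OF geo]) simp
    have "(h k has_sum bailey_sum q \<beta> k) UNIV"
      unfolding bailey_sum_def h_def[symmetric]
      by (intro norm_summable_imp_has_sum n summable_sums summable_norm_cancel[OF n])
    then show ?thesis
      by (simp add: fh has_sum_cmult_right)
  qed
  ultimately have "((\<lambda>k. g k * bailey_sum q \<beta> k) has_sum S) UNIV"
    by (rule has_sum_SigmaD) 
  then have "(\<lambda>k. g k * bailey_sum q \<beta> k) sums S"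
    by (rule has_sum_imp_sums)
  then show ?thesis
    unfolding S_eq g_def by (simp only: mult.assoc)
qed

subsection \<open>The three identities\<close>

text \<open>The common last step of the three identities. At \<open>n = r\<close> the power of
  \<open>q\<close> splits into a part in \<open>m\<close> and a theta summand \<open>t m r\<close>;
  at \<open>n = - (r + 1)\<close> there is an extra factor \<open>\<delta> m\<close>. Pairing yields
  \<open>1 + \<delta> m\<close> times a theta function, which \<open>key\<close> identifies with the
  Bailey side.\<close>

lemma indefinite_sum_from_bailey:
  fixes q z C X :: complex and G :: "nat \<Rightarrow> int \<Rightarrow> complex" and w :: "int \<Rightarrow> nat"
  assumes q: "norm q < 1"
    and Gpos: "\<And>m r. G m (int r) = (-1) ^ m * q ^ e m * t m r"
    and Gneg: "\<And>m r. G m (- int (Suc r)) = \<delta> m * ((-1) ^ m * q ^ e m * t m r)"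
    and e: "\<And>m. m choose 2 \<le> e m" and t: "\<And>m r. norm (t m r) \<le> norm q ^ r"
    and \<delta>: "\<And>m. norm (\<delta> m) \<le> 1"
    and A: "\<And>j. finite (A j)" "\<And>j n. n \<in> A j \<longleftrightarrow> w n \<le> j"
    and F: "(\<lambda>k. centred_monomial z k * F k) sums X"
    and key: "\<And>m. C * F m = (-1) ^ m * q ^ e m * (1 + \<delta> m) * (\<Sum>r. t m r)"
  shows "(\<Sum>j. \<Sum>n\<in>A j. centred_monomial z (j - w n) * G (j - w n) n) = C * X"
proof -
  have G1: "norm (G m (int r)) \<le> norm q ^ (m choose 2) * norm q ^ r" for m r
  proof -
    have "norm (G m (int r)) = norm (q ^ e m) * norm (t m r)"
      by (simp add: Gpos norm_mult norm_power)
    also have "\<dots> \<le> norm q ^ (m choose 2) * norm q ^ r"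
      by (intro mult_mono norm_power_le_power q e t) auto
    finally show ?thesis .
  qed
  have G2: "norm (G m (- int (Suc r))) \<le> norm q ^ (m choose 2) * norm q ^ r" for m r
  proof -
    have "norm (G m (- int (Suc r))) = norm (\<delta> m) * norm (G m (int r))"
      unfolding Gneg Gpos norm_mult ..
    also have "\<dots> \<le> norm (G m (int r))"
      using \<delta>[of m] by (intro mult_left_le_one_le) auto
    finally show ?thesis
      using G1[of m r] by linarith
  qed
  have t_summable: "summable (t m)" for m
    using t q by (intro norm_suminf_le_geometric(1)) auto
  have inner: "(\<Sum>r. G m (int r) + G m (- int (Suc r))) = C * F m" for m
  proof -
    have "G m (int r) + G m (- int (Suc r)) = (-1) ^ m * q ^ e m * (1 + \<delta> m) * t m r" for r
      unfolding Gpos Gneg by (simp add: algebra_simps)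
    then show ?thesis
      unfolding key by (simp only: suminf_mult[OF t_summable])
  qed
  have "(\<Sum>j. \<Sum>n\<in>A j. centred_monomial z (j - w n) * G (j - w n) n) =
      (\<Sum>m. centred_monomial z m * (C * F m))"
    unfolding inner[symmetric] using q by (intro indefinite_sum_eq[where c = "norm q"] G1 G2 A) auto
  also have "\<dots> = (\<Sum>m. C * (centred_monomial z m * F m))"
    by (simp only: mult.left_commute)
  also have "\<dots> = C * X"
    using sums_mult[OF F, of C] by (simp add: sums_iff)
  finally show ?thesis .
qed

lemma centred_monomial_eq:
  assumes "z \<noteq> 0"
  shows "(1 - z powi (int m + 1)) * (1 - z powi int m) * z powi (- int m) = centred_monomial z m"
proof -
  have "z powi (int m + 1) = z * z ^ m"
    using assms by (simp add: power_int_add)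
  moreover have "z powi (- int m) = inverse (z ^ m)"
    by (simp add: power_int_minus)
  moreover have "z ^ m \<noteq> 0"
    using assms by simp
  ultimately show ?thesis
    by (simp add: centred_monomial_def power_inverse divide_simps) (simp add: algebra_simps)
qed

lemma two_choose_two: "2 * int (Suc x choose 2) = int x * (int x + 1)"
  by (induction x) (simp_all add: choose_two_Suc[of "Suc _"] numeral_2_eq_2 algebra_simps)

text \<open>Replaces the integer division in the exponents by a binomial coefficient, whose double
  is a polynomial.\<close>

lemma choose_two_int: "int x * (int x + 1) div 2 = int (Suc x choose 2)"
  unfolding two_choose_two[symmetric] by simp

text \<open>By \<open>qpoch_double\<close>, the weight cancels half of
  \<open>qpoch q q (2 * n)\<close> and leaves the summand of \<open>theta_sum_L9\<close>.\<close>

lemma bailey_sum_L9: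
  fixes q :: complex
  assumes q: "norm q < 1"
  shows "qpoch_inf q q * qpoch_inf q (q\<^sup>2) * bailey_sum q (\<lambda>n. inverse (qpoch q (q\<^sup>2) n)) k
    = partial_theta (-1) q k"
proof -
  define C where "C = qpoch_inf q q * qpoch_inf q (q\<^sup>2)"
  have p: "norm (q\<^sup>2) < 1"
    using q by (simp add: norm_power power_less_one_iff)
  have C: "C \<noteq> 0"
    unfolding C_def using qpoch_inf_nonzero[OF q q] qpoch_inf_nonzero[OF q p] by simp
  have "inverse (qpoch q (q\<^sup>2) n) * qpoch q q (2 * n) = qpoch (q\<^sup>2) (q\<^sup>2) n" for n
    using qpoch_nonzero[OF q p, of n] by (simp add: qpoch_double power2_eq_square)
  then have "(\<lambda>r. C * (q ^ r * inverse (qpoch q (q\<^sup>2) (k + r)) * qpoch q q (2 * (k + r)) /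
      (qpoch q q r * qpoch q q (2 * k + r + 1)))) sums partial_theta (-1) q k"
    using theta_sum_L9[OF q, of k] unfolding C_def[symmetric] by (simp only: mult.assoc)
  \<comment> \<open>Division by the nonzero \<open>C\<close> transfers convergence to the unscaled
    Bailey series.\<close>
  from sums_mult_D[OF this C] show ?thesis
    unfolding bailey_sum_def C_def[symmetric] using C by (simp add: sums_iff)
qed

lemma bailey_sum_L12:
  fixes q :: complex
  assumes q: "norm q < 1"
  defines "p \<equiv> q\<^sup>2"
  shows "qpoch_inf p p * (qpoch_inf (-q) p)\<^sup>2 * (1 - q ^ (2 * k + 1))
    * bailey_sum p (\<lambda>n. inverse (qpoch (-q) p n * qpoch (-q) p (n + 1))) k = partial_theta 1 q k"
proof -
  define C where "C = qpoch_inf p p * (qpoch_inf (-q) p)\<^sup>2 * (1 - q ^ (2 * k + 1))"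
  have p: "norm p < 1" and q': "norm (- q) < 1"
    using q by (simp_all add: p_def norm_power power_less_one_iff)
  have C: "C \<noteq> 0"
    unfolding C_def using qpoch_inf_nonzero[OF p p] qpoch_inf_nonzero[OF q' p]
      one_minus_power_Suc_nonzero[OF q, of "2 * k"] by simp
  have "(\<lambda>r. C * (p ^ r * inverse (qpoch (-q) p (k + r) * qpoch (-q) p (k + r + 1)) * qpoch p p (2 * (k + r)) /
      (qpoch p p r * qpoch p p (2 * k + r + 1)))) sums partial_theta 1 q k"
    using theta_sum_L12[OF q, of k] unfolding C_def[symmetric] p_def[symmetric]
    by (simp add: divide_inverse mult_ac)
  from sums_mult_D[OF this C] show ?thesis
    unfolding bailey_sum_def C_def[symmetric] using C by (simp add: sums_iff)
qed

text \<open>By \<open>qpoch_mult_minus\<close>, the weight reduces \<open>qpoch p p (2 * n)\<close>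
  to \<open>qpoch q q (2 * n)\<close>.\<close>

lemma bailey_sum_L7:
  fixes q :: complex
  assumes q: "norm q < 1"
  defines "p \<equiv> q\<^sup>2"
  shows "qpoch_inf p p * qpoch_inf (-q) q * (1 - q ^ (2 * k + 1))
    * bailey_sum p (\<lambda>n. inverse (qpoch (-q) q (2 * n))) k = half_theta q k"
proof -
  define C where "C = qpoch_inf p p * qpoch_inf (-q) q * (1 - q ^ (2 * k + 1))"
  have p: "norm p < 1" and q': "norm (- q) < 1"
    using q by (simp_all add: p_def norm_power power_less_one_iff)
  have C: "C \<noteq> 0"
    unfolding C_def using qpoch_inf_nonzero[OF p p] qpoch_inf_nonzero[OF q' q]
      one_minus_power_Suc_nonzero[OF q, of "2 * k"] by simp
  have "inverse (qpoch (-q) q (2 * n)) * qpoch p p (2 * n) = qpoch q q (2 * n)" for n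
    using qpoch_nonzero[OF q' q, of "2 * n"] qpoch_mult_minus[of q q "2 * n"]
    by (simp add: p_def field_simps)
  then have "(\<lambda>r. C * (p ^ r * inverse (qpoch (-q) q (2 * (k + r))) * qpoch p p (2 * (k + r)) /
      (qpoch p p r * qpoch p p (2 * k + r + 1)))) sums half_theta q k"
    using theta_sum_L7[OF q, of k] unfolding C_def[symmetric] p_def[symmetric] by (simp only: mult.assoc)
  from sums_mult_D[OF this C] show ?thesis
    unfolding bailey_sum_def C_def[symmetric] using C by (simp add: sums_iff)
qed

lemma quotient_eq_of_scaled_eq:
  fixes a b c x P K R :: complex
  assumes "R = P * K * (c * x)" "P \<noteq> 0" "c \<noteq> 0"
  shows "K / (a * b) * x = 1 / (c * (P * a * b)) * R"
  \<comment> \<open>If \<open>a\<close> or \<open>b\<close> is 0, both sides are 0 by the convention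
    for division by zero; otherwise the denominators are cleared.\<close>
  using assms by (cases "a = 0"; cases "b = 0") (simp_all add: divide_simps)

text \<open>With \<open>j = m + 2 * \<bar>n\<bar>\<close>, the values \<open>n = r\<close> and
  \<open>n = - (r + 1)\<close> give the same theta summand, up to the factor
  \<open>- (q ^ (2 * m + 1))\<close>. Pairing them produces the \<open>1 - q ^ (2 * m + 1)\<close>
  of the transform.\<close>

lemma S_L9_eq:
  fixes q z :: complex
  assumes q: "norm q < 1" and z: "z \<noteq> 0" "z \<noteq> -1"
  shows "S_L9 z q =
           1 / ((1 + z) * (qpoch_inf q q * qpoch_inf z q * qpoch_inf (inverse z) q)) *
           (\<Sum>j::nat. \<Sum>n\<in>{- (int j div 2)..int j div 2}.
              (1 - z powi (int j - 2 * \<bar>n\<bar> + 1)) * (1 - z powi (int j - 2 * \<bar>n\<bar>)) * z powi (2 * \<bar>n\<bar> - int j)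
              * (-1) powi (int j + n) * q powi (int j * (int j + 1) div 2 - n * (n - 1)))"
proof -
  define w :: "int \<Rightarrow> nat" where "w n = 2 * nat \<bar>n\<bar>" for n
  define G where "G m n = (-1) powi (int (m + w n) + n) *
      q powi (int (m + w n) * (int (m + w n) + 1) div 2 - n * (n - 1))" for m n
  define \<beta> where "\<beta> n = inverse (qpoch q (q\<^sup>2) n)" for n
  have p: "norm (q\<^sup>2) < 1"
    using q by (simp add: norm_power power_less_one_iff)
  obtain M where M: "\<And>n. norm (\<beta> n) \<le> M"
    unfolding \<beta>_def using inverse_qpoch_bounded[OF q p] by blast
  define X where "X = (\<Sum>n. qpoch z q (Suc n) * qpoch (inverse z) q (Suc n) * q ^ Suc n * \<beta> (Suc n))"
  have scaled: "(\<Sum>j. \<Sum>n\<in>{- (int j div 2)..int j div 2}. centred_monomial z (j - w n) * G (j - w n) n) =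
      qpoch_inf q q * qpoch_inf q (q\<^sup>2) * ((1 + z) * X)"
  proof (rule indefinite_sum_from_bailey[OF q, where e = "\<lambda>m. Suc m choose 2"
        and t = "\<lambda>m r. (-1) ^ r * q ^ (r\<^sup>2 + 2 * (m + 1) * r)" and \<delta> = "\<lambda>m. - (q ^ (2 * m + 1))"])
    show "G m (int r) = (-1) ^ m * q ^ (Suc m choose 2) * ((-1) ^ r * q ^ (r\<^sup>2 + 2 * (m + 1) * r))" for m r
    proof -
      have s: "int (m + w (int r)) + int r = int (m + r + 2 * r)"
        by (simp add: w_def)
      have "int (m + w (int r)) * (int (m + w (int r)) + 1) div 2 - int r * (int r - 1) =
          int ((Suc m choose 2) + (r\<^sup>2 + 2 * (m + 1) * r))"
        unfolding choose_two_int using two_choose_two[of "m + 2 * r"] two_choose_two[of m]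
        by (simp add: w_def power2_eq_square algebra_simps)
      then show ?thesis
        unfolding G_def s by (simp only: power_int_of_nat power_add power_mult) simp
    qed
    show "G m (- int (Suc r)) = - (q ^ (2 * m + 1)) *
        ((-1) ^ m * q ^ (Suc m choose 2) * ((-1) ^ r * q ^ (r\<^sup>2 + 2 * (m + 1) * r)))" for m r
    proof -
      have w: "w (- int (Suc r)) = 2 * Suc r"
        by (simp only: w_def abs_minus_cancel abs_of_nat nat_int)
      have s: "int (m + w (- int (Suc r))) + - int (Suc r) = int (m + Suc r)"
        unfolding w by simp
      have "int (m + w (- int (Suc r))) * (int (m + w (- int (Suc r))) + 1) div 2
            - - int (Suc r) * (- int (Suc r) - 1) =
          int ((2 * m + 1) + (Suc m choose 2) + (r\<^sup>2 + 2 * (m + 1) * r))"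
        unfolding choose_two_int w using two_choose_two[of "m + 2 * Suc r"] two_choose_two[of m]
        by (simp add: power2_eq_square algebra_simps)
      then show ?thesis
        unfolding G_def s by (simp only: power_int_of_nat power_add) simp
    qed
    show "m choose 2 \<le> Suc m choose 2" for m
      by (simp add: choose_two_Suc)
    show "norm ((-1) ^ r * q ^ (r\<^sup>2 + 2 * (m + 1) * r)) \<le> norm q ^ r" for m r
      by (rule partial_theta_term_bound[OF q]) simp
    show "norm (- (q ^ (2 * m + 1))) \<le> 1" for m
      using norm_power_le_power[OF q, of 0 "2 * m + 1"] by simp
    show "n \<in> {- (int j div 2)..int j div 2} \<longleftrightarrow> w n \<le> j" for j n
      unfolding w_def by auto
    show "(\<lambda>k. centred_monomial z k *
            ((-1) ^ k * q ^ (Suc k choose 2) * (1 - q ^ (2 * k + 1)) * bailey_sum q \<beta> k)) sums ((1 + z) * X)"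
      unfolding X_def by (rule bailey_transform[OF q z M])
    show "qpoch_inf q q * qpoch_inf q (q\<^sup>2) *
        ((-1) ^ m * q ^ (Suc m choose 2) * (1 - q ^ (2 * m + 1)) * bailey_sum q \<beta> m) =
        (-1) ^ m * q ^ (Suc m choose 2) * (1 + - (q ^ (2 * m + 1)))
          * (\<Sum>r. (-1) ^ r * q ^ (r\<^sup>2 + 2 * (m + 1) * r))" for m
      unfolding partial_theta_def[symmetric] bailey_sum_L9[OF q, symmetric] \<beta>_def
      by (simp add: mult_ac)
  qed simp
  have sum_eq: "(\<Sum>j. \<Sum>n\<in>{- (int j div 2)..int j div 2}.
      (1 - z powi (int j - 2 * \<bar>n\<bar> + 1)) * (1 - z powi (int j - 2 * \<bar>n\<bar>)) * z powi (2 * \<bar>n\<bar> - int j)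
        * (-1) powi (int j + n) * q powi (int j * (int j + 1) div 2 - n * (n - 1))) =
      (\<Sum>j. \<Sum>n\<in>{- (int j div 2)..int j div 2}. centred_monomial z (j - w n) * G (j - w n) n)"
  proof (intro suminf_cong sum.cong refl)
    fix j n
    assume n: "n \<in> {- (int j div 2)..int j div 2}"
    define m where "m = j - w n"
    \<comment> \<open>The range of \<open>n\<close> makes the natural subtraction in
      \<open>m\<close> exact, so the integer exponents may be rewritten through
      \<open>m\<close>.\<close>
    have "w n \<le> j"
      using n unfolding w_def by auto
    then have m: "int j - 2 * \<bar>n\<bar> = int m" "2 * \<bar>n\<bar> - int j = - int m" "m + w n = j"
      by (auto simp: m_def w_def)
    show "(1 - z powi (int j - 2 * \<bar>n\<bar> + 1)) * (1 - z powi (int j - 2 * \<bar>n\<bar>)) * z powi (2 * \<bar>n\<bar> - int j)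
        * (-1) powi (int j + n) * q powi (int j * (int j + 1) div 2 - n * (n - 1)) =
        centred_monomial z (j - w n) * G (j - w n) n"
      unfolding m_def[symmetric] G_def m centred_monomial_eq[OF z(1)] by (simp only: mult.assoc)
  qed
  have S_eq: "S_L9 z q = qpoch_inf q (q\<^sup>2) / (qpoch_inf z q * qpoch_inf (inverse z) q) * X"
    unfolding S_L9_def X_def \<beta>_def divide_inverse ..
  have nz: "1 + z \<noteq> 0"
    using z(2) by (simp add: add_eq_0_iff)
  show ?thesis
    unfolding S_eq sum_eq by (rule quotient_eq_of_scaled_eq[OF scaled qpoch_inf_nonzero[OF q q] nz])
qed

text \<open>Here \<open>j = m + \<bar>n\<bar>\<close>, the theta exponent is triangular, and the
  factor between the paired values of \<open>n\<close> is \<open>q ^ (2 * m + 1)\<close>.\<close>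

lemma S_L7_eq:
  fixes q z :: complex
  assumes q: "norm q < 1" and z: "z \<noteq> 0" "z \<noteq> -1"
  shows "S_L7 z q =
           1 / ((1 + z) * (qpoch_inf (q^2) (q^2) * qpoch_inf z (q^2) * qpoch_inf (inverse z) (q^2))) *
           (\<Sum>j::nat. \<Sum>n\<in>{- int j..int j}.
              (1 - z powi (int j - \<bar>n\<bar> + 1)) * (1 - z powi (int j - \<bar>n\<bar>)) * z powi (\<bar>n\<bar> - int j)
              * (-1) powi (int j + n) * q powi (int j * (int j + 1) - n * (n - 1) div 2))"
proof -
  define p where "p = q\<^sup>2"
  define w :: "int \<Rightarrow> nat" where "w n = nat \<bar>n\<bar>" for n
  define G where "G m n = (-1) powi (int (m + w n) + n) * q powi (int (m + w n) * (int (m + w n) + 1) - n * (n - 1) div 2)" for m n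
  define \<beta> where "\<beta> n = inverse (qpoch (-q) q (2 * n))" for n
  have p: "norm p < 1" and q': "norm (- q) < 1"
    using q by (simp_all add: p_def norm_power power_less_one_iff)
  obtain M where "\<And>n. norm (inverse (qpoch (-q) q n)) \<le> M"
    using inverse_qpoch_bounded[OF q' q] by blast
  then have M: "norm (\<beta> n) \<le> M" for n
    unfolding \<beta>_def .
  define X where "X = (\<Sum>n. qpoch z p (Suc n) * qpoch (inverse z) p (Suc n) * p ^ Suc n * \<beta> (Suc n))"
  have scaled: "(\<Sum>j. \<Sum>n\<in>{- int j..int j}. centred_monomial z (j - w n) * G (j - w n) n) =
      qpoch_inf p p * qpoch_inf (-q) q * ((1 + z) * X)"
  proof (rule indefinite_sum_from_bailey[OF q, where e = "\<lambda>m. 2 * (Suc m choose 2)"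
        and t = "\<lambda>m r. q ^ ((r choose 2) + 2 * (m + 1) * r)" and \<delta> = "\<lambda>m. q ^ (2 * m + 1)"])
    show "G m (int r) = (-1) ^ m * q ^ (2 * (Suc m choose 2)) * q ^ ((r choose 2) + 2 * (m + 1) * r)" for m r
    proof -
      have s: "int (m + w (int r)) + int r = int (m + 2 * r)"
        by (simp add: w_def)
      have "int r * (int r - 1) div 2 = int (r choose 2)"
        using choose_two_int[of "r - 1"] by (cases r) (simp_all add: numeral_2_eq_2 mult.commute add.commute)
      moreover have "int r * int r = 2 * int (r choose 2) + int r"
        using two_choose_two[of r] by (simp add: choose_two_Suc algebra_simps)
      ultimately have "int (m + w (int r)) * (int (m + w (int r)) + 1) - int r * (int r - 1) div 2 =
          int (2 * (Suc m choose 2) + ((r choose 2) + 2 * (m + 1) * r))"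
        using two_choose_two[of m] by (simp add: w_def algebra_simps)
      then show ?thesis
        unfolding G_def s by (simp only: power_int_of_nat power_add power_mult) simp
    qed
    show "G m (- int (Suc r)) = q ^ (2 * m + 1) * ((-1) ^ m * q ^ (2 * (Suc m choose 2)) * q ^ ((r choose 2) + 2 * (m + 1) * r))" for m r
    proof -
      have w: "w (- int (Suc r)) = Suc r"
        by (simp only: w_def abs_minus_cancel abs_of_nat nat_int)
      have s: "int (m + w (- int (Suc r))) + - int (Suc r) = int m"
        unfolding w by simp
      have "- int (Suc r) * (- int (Suc r) - 1) div 2 = int (Suc (Suc r) choose 2)"
        unfolding choose_two_int[symmetric] by (simp add: algebra_simps)
      then have "- int (Suc r) * (- int (Suc r) - 1) div 2 = int (r choose 2) + 2 * int r + 1"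
        by (simp add: choose_two_Suc)
      moreover have "int r * int r = 2 * int (r choose 2) + int r"
        using two_choose_two[of r] by (simp add: choose_two_Suc algebra_simps)
      ultimately have "int (m + w (- int (Suc r))) * (int (m + w (- int (Suc r))) + 1)
            - - int (Suc r) * (- int (Suc r) - 1) div 2 =
          int ((2 * m + 1) + 2 * (Suc m choose 2) + ((r choose 2) + 2 * (m + 1) * r))"
        unfolding w using two_choose_two[of m] by (simp add: algebra_simps)
      then show ?thesis
        unfolding G_def s by (simp only: power_int_of_nat power_add) simp
    qed
    show "m choose 2 \<le> 2 * (Suc m choose 2)" for m
      by (simp add: choose_two_Suc)
    show "norm (q ^ ((r choose 2) + 2 * (m + 1) * r)) \<le> norm q ^ r" for m r
      by (rule half_theta_term_bound[OF q])
    show "norm (q ^ (2 * m + 1)) \<le> 1" for m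
      using norm_power_le_power[OF q, of 0 "2 * m + 1"] by simp
    show "n \<in> {- int j..int j} \<longleftrightarrow> w n \<le> j" for j n
      unfolding w_def by auto
    show "(\<lambda>k. centred_monomial z k *
            ((-1) ^ k * p ^ (Suc k choose 2) * (1 - p ^ (2 * k + 1)) * bailey_sum p \<beta> k)) sums ((1 + z) * X)"
      unfolding X_def by (rule bailey_transform[OF p z M])
    show "qpoch_inf p p * qpoch_inf (-q) q *
        ((-1) ^ m * p ^ (Suc m choose 2) * (1 - p ^ (2 * m + 1)) * bailey_sum p \<beta> m) =
        (-1) ^ m * q ^ (2 * (Suc m choose 2)) * (1 + q ^ (2 * m + 1)) * (\<Sum>r. q ^ ((r choose 2) + 2 * (m + 1) * r))" for m
    proof -
      \<comment> \<open>The first factor belongs to the coefficient evaluation, the second is the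
        \<open>1 + \<delta> m\<close> from the pairing.\<close>
      have "1 - p ^ (2 * m + 1) = (1 - q ^ (2 * m + 1)) * (1 + q ^ (2 * m + 1))"
        unfolding p_def power_square_double by (simp add: algebra_simps flip: power_add)
      moreover have "p ^ (Suc m choose 2) = q ^ (2 * (Suc m choose 2))"
        unfolding p_def power_square_double ..
      ultimately show ?thesis
        unfolding half_theta_def[symmetric] bailey_sum_L7[OF q, symmetric] \<beta>_def p_def[symmetric]
        by (simp add: mult_ac)
    qed
  qed simp
  have sum_eq: "(\<Sum>j. \<Sum>n\<in>{- int j..int j}.
      (1 - z powi (int j - \<bar>n\<bar> + 1)) * (1 - z powi (int j - \<bar>n\<bar>)) * z powi (\<bar>n\<bar> - int j)
        * (-1) powi (int j + n) * q powi (int j * (int j + 1) - n * (n - 1) div 2)) =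
      (\<Sum>j. \<Sum>n\<in>{- int j..int j}. centred_monomial z (j - w n) * G (j - w n) n)"
  proof (intro suminf_cong sum.cong refl)
    fix j n
    assume n: "n \<in> {- int j..int j}"
    define m where "m = j - w n"
    have "w n \<le> j"
      using n unfolding w_def by auto
    then have m: "int j - \<bar>n\<bar> = int m" "\<bar>n\<bar> - int j = - int m" "m + w n = j"
      by (auto simp: m_def w_def)
    show "(1 - z powi (int j - \<bar>n\<bar> + 1)) * (1 - z powi (int j - \<bar>n\<bar>)) * z powi (\<bar>n\<bar> - int j)
        * (-1) powi (int j + n) * q powi (int j * (int j + 1) - n * (n - 1) div 2) =
        centred_monomial z (j - w n) * G (j - w n) n"
      unfolding m_def[symmetric] G_def m centred_monomial_eq[OF z(1)] by (simp only: mult.assoc)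
  qed
  have S_eq: "S_L7 z q = qpoch_inf (-q) q / (qpoch_inf z p * qpoch_inf (inverse z) p) * X"
    unfolding S_L7_def X_def \<beta>_def divide_inverse p_def power_square_double ..
  have nz: "1 + z \<noteq> 0"
    using z(2) by (simp add: add_eq_0_iff)
  show ?thesis
    unfolding S_eq sum_eq p_def[symmetric]
    by (rule quotient_eq_of_scaled_eq[OF scaled qpoch_inf_nonzero[OF p p] nz])
qed

text \<open>The same substitution as for L7; the exponent \<open>j * (j + 1) + n\<close> now yields
  squares, hence \<open>partial_theta\<close>.\<close>

lemma S_L12_eq:
  fixes q z :: complex
  assumes q: "norm q < 1" and z: "z \<noteq> 0" "z \<noteq> -1"
  shows "S_L12 z q =
           1 / ((1 + z) * (qpoch_inf (q^2) (q^2) * qpoch_inf z (q^2) * qpoch_inf (inverse z) (q^2))) *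
           (\<Sum>j::nat. \<Sum>n\<in>{- int j..int j}.
              (1 - z powi (int j - \<bar>n\<bar> + 1)) * (1 - z powi (int j - \<bar>n\<bar>)) * z powi (\<bar>n\<bar> - int j)
              * (-1) powi (int j + n) * q powi (int j * (int j + 1) + n))"
proof -
  define p where "p = q\<^sup>2"
  define w :: "int \<Rightarrow> nat" where "w n = nat \<bar>n\<bar>" for n
  define G where "G m n = (-1) powi (int (m + w n) + n) * q powi (int (m + w n) * (int (m + w n) + 1) + n)" for m n
  define \<beta> where "\<beta> n = inverse (qpoch (-q) p n * qpoch (-q) p (n + 1))" for n
  have p: "norm p < 1" and q': "norm (- q) < 1"
    using q by (simp_all add: p_def norm_power power_less_one_iff)
  obtain M' where M': "M' > 0" "\<And>n. norm (inverse (qpoch (-q) p n)) \<le> M'"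
    using inverse_qpoch_bounded[OF q' p] by blast
  have M: "norm (\<beta> n) \<le> M' * M'" for n
    unfolding \<beta>_def inverse_mult_distrib norm_mult using M' by (intro mult_mono) auto
  define X where "X = (\<Sum>n. qpoch z p (Suc n) * qpoch (inverse z) p (Suc n) * p ^ Suc n * \<beta> (Suc n))"
  have scaled: "(\<Sum>j. \<Sum>n\<in>{- int j..int j}. centred_monomial z (j - w n) * G (j - w n) n) =
      qpoch_inf p p * (qpoch_inf (-q) p)\<^sup>2 * ((1 + z) * X)"
  \<comment> \<open>The factor \<open>1 ^ r\<close> keeps the summand in the literal form of
    \<open>partial_theta 1\<close>.\<close>
  proof (rule indefinite_sum_from_bailey[OF q, where e = "\<lambda>m. 2 * (Suc m choose 2)"
        and t = "\<lambda>m r. (1 ^ r * q ^ (r\<^sup>2 + 2 * (m + 1) * r))" and \<delta> = "\<lambda>m. q ^ (2 * m + 1)"])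
    show "G m (int r) = (-1) ^ m * q ^ (2 * (Suc m choose 2)) * (1 ^ r * q ^ (r\<^sup>2 + 2 * (m + 1) * r))" for m r
    proof -
      have s: "int (m + w (int r)) + int r = int (m + 2 * r)"
        by (simp add: w_def)
      have "int (m + w (int r)) * (int (m + w (int r)) + 1) + int r =
          int (2 * (Suc m choose 2) + (r\<^sup>2 + 2 * (m + 1) * r))"
        using two_choose_two[of m] by (simp add: w_def power2_eq_square algebra_simps)
      then show ?thesis
        unfolding G_def s by (simp only: power_int_of_nat power_add power_mult) simp
    qed
    show "G m (- int (Suc r)) = q ^ (2 * m + 1) * ((-1) ^ m * q ^ (2 * (Suc m choose 2)) * (1 ^ r * q ^ (r\<^sup>2 + 2 * (m + 1) * r)))" for m r
    proof -
      have w: "w (- int (Suc r)) = Suc r"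
        by (simp only: w_def abs_minus_cancel abs_of_nat nat_int)
      have s: "int (m + w (- int (Suc r))) + - int (Suc r) = int m"
        unfolding w by simp
      have "int (m + w (- int (Suc r))) * (int (m + w (- int (Suc r))) + 1) + - int (Suc r) =
          int ((2 * m + 1) + 2 * (Suc m choose 2) + (r\<^sup>2 + 2 * (m + 1) * r))"
        unfolding w using two_choose_two[of m] by (simp add: power2_eq_square algebra_simps)
      then show ?thesis
        unfolding G_def s by (simp only: power_int_of_nat power_add) simp
    qed
    show "m choose 2 \<le> 2 * (Suc m choose 2)" for m
      by (simp add: choose_two_Suc)
    show "norm ((1 ^ r * q ^ (r\<^sup>2 + 2 * (m + 1) * r))) \<le> norm q ^ r" for m r
      by (rule partial_theta_term_bound[OF q]) simp
    show "norm (q ^ (2 * m + 1)) \<le> 1" for m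
      using norm_power_le_power[OF q, of 0 "2 * m + 1"] by simp
    show "n \<in> {- int j..int j} \<longleftrightarrow> w n \<le> j" for j n
      unfolding w_def by auto
    show "(\<lambda>k. centred_monomial z k *
            ((-1) ^ k * p ^ (Suc k choose 2) * (1 - p ^ (2 * k + 1)) * bailey_sum p \<beta> k)) sums ((1 + z) * X)"
      unfolding X_def by (rule bailey_transform[OF p z M])
    show "qpoch_inf p p * (qpoch_inf (-q) p)\<^sup>2 *
        ((-1) ^ m * p ^ (Suc m choose 2) * (1 - p ^ (2 * m + 1)) * bailey_sum p \<beta> m) =
        (-1) ^ m * q ^ (2 * (Suc m choose 2)) * (1 + q ^ (2 * m + 1)) * (\<Sum>r. (1 ^ r * q ^ (r\<^sup>2 + 2 * (m + 1) * r)))" for m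
    proof -
      have "1 - p ^ (2 * m + 1) = (1 - q ^ (2 * m + 1)) * (1 + q ^ (2 * m + 1))"
        unfolding p_def power_square_double by (simp add: algebra_simps flip: power_add)
      moreover have "p ^ (Suc m choose 2) = q ^ (2 * (Suc m choose 2))"
        unfolding p_def power_square_double ..
      ultimately show ?thesis
        unfolding partial_theta_def[symmetric] bailey_sum_L12[OF q, symmetric] \<beta>_def p_def[symmetric]
        by (simp add: mult_ac)
    qed
  qed simp
  have sum_eq: "(\<Sum>j. \<Sum>n\<in>{- int j..int j}.
      (1 - z powi (int j - \<bar>n\<bar> + 1)) * (1 - z powi (int j - \<bar>n\<bar>)) * z powi (\<bar>n\<bar> - int j)
        * (-1) powi (int j + n) * q powi (int j * (int j + 1) + n)) =
      (\<Sum>j. \<Sum>n\<in>{- int j..int j}. centred_monomial z (j - w n) * G (j - w n) n)"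
  proof (intro suminf_cong sum.cong refl)
    fix j n
    assume n: "n \<in> {- int j..int j}"
    define m where "m = j - w n"
    have "w n \<le> j"
      using n unfolding w_def by auto
    then have m: "int j - \<bar>n\<bar> = int m" "\<bar>n\<bar> - int j = - int m" "m + w n = j"
      by (auto simp: m_def w_def)
    show "(1 - z powi (int j - \<bar>n\<bar> + 1)) * (1 - z powi (int j - \<bar>n\<bar>)) * z powi (\<bar>n\<bar> - int j)
        * (-1) powi (int j + n) * q powi (int j * (int j + 1) + n) =
        centred_monomial z (j - w n) * G (j - w n) n"
      unfolding m_def[symmetric] G_def m centred_monomial_eq[OF z(1)] by (simp only: mult.assoc)
  qed
  have S_eq: "S_L12 z q = (qpoch_inf (-q) p)\<^sup>2 / (qpoch_inf z p * qpoch_inf (inverse z) p) * X"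
    unfolding S_L12_def X_def \<beta>_def divide_inverse p_def power_square_double ..
  have nz: "1 + z \<noteq> 0"
    using z(2) by (simp add: add_eq_0_iff)
  show ?thesis
    unfolding S_eq sum_eq p_def[symmetric]
    by (rule quotient_eq_of_scaled_eq[OF scaled qpoch_inf_nonzero[OF p p] nz])
qed

theorem theorem2p4:
  fixes q z :: complex
  assumes "norm q < 1"
    and "z \<noteq> 0"
    and "qpoch_inf z q * qpoch_inf (inverse z) q \<noteq> 0"
    and "z \<noteq> -1"
  shows "S_L7 z q =
           1 / ((1 + z) * (qpoch_inf (q^2) (q^2) * qpoch_inf z (q^2) * qpoch_inf (inverse z) (q^2))) *
           (\<Sum>j::nat. \<Sum>n\<in>{- int j..int j}.
              (1 - z powi (int j - \<bar>n\<bar> + 1)) * (1 - z powi (int j - \<bar>n\<bar>)) * z powi (\<bar>n\<bar> - int j)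
              * (-1) powi (int j + n) * q powi (int j * (int j + 1) - n * (n - 1) div 2))
       \<and> S_L9 z q =
           1 / ((1 + z) * (qpoch_inf q q * qpoch_inf z q * qpoch_inf (inverse z) q)) *
           (\<Sum>j::nat. \<Sum>n\<in>{- (int j div 2)..int j div 2}.
              (1 - z powi (int j - 2 * \<bar>n\<bar> + 1)) * (1 - z powi (int j - 2 * \<bar>n\<bar>)) * z powi (2 * \<bar>n\<bar> - int j)
              * (-1) powi (int j + n) * q powi (int j * (int j + 1) div 2 - n * (n - 1)))
       \<and> S_L12 z q =
           1 / ((1 + z) * (qpoch_inf (q^2) (q^2) * qpoch_inf z (q^2) * qpoch_inf (inverse z) (q^2))) *
           (\<Sum>j::nat. \<Sum>n\<in>{- int j..int j}.
              (1 - z powi (int j - \<bar>n\<bar> + 1)) * (1 - z powi (int j - \<bar>n\<bar>)) * z powi (\<bar>n\<bar> - int j)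
              * (-1) powi (int j + n) * q powi (int j * (int j + 1) + n))"
  using S_L7_eq S_L9_eq S_L12_eq assms(1,2,4) by blast

end
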